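(* Let $1\le p\le\infty$, $d\in\mathbb N$, and $1\le q_1<\dots<q_d<\infty$ with $p\neq q_i$ for all $i\in\{1,\dots,d\}$. For each $n\in\mathbb N$ let $Z=Z_n$ be a random vector uniformly distributed in $\mathbb B_p^n$. Then, as $n\to\infty$, \[ \sqrt n\Big(n^{1/p-1/q_i}\frac{\|Z\|_{q_i}}{M_p(q_i)^{1/q_i}}-1\Big)_{i=1}^d\ \xrightarrow{d}\ N, \] where $N$ is a centered Gaussian random vector in $\mathbb R^d$ with covariance matrix $\mathbf C=(c_{ij})_{i,j=1}^d$ given by \[ c_{ij}=\frac{C_p(q_i,q_j)}{q_iq_jM_p(q_i)M_p(q_j)}+\frac{C_p(p,p)}{p^2}-\frac1p\Big(\frac{C_p(q_i,p)}{q_iM_p(q_i)}+\frac{C_p(q_j,p)}{q_jM_p(q_j)}\Big), \] which equals \[ c_{ij}=\begin{cases}\frac{1}{q_iq_j}\Big(\frac{\Gamma(\frac1p)\Gamma(\frac{q_i+q_j+1}{p})}{\Gamma(\frac{q_i+1}{p})\Gamma(\frac{q_j+1}{p})}-1\Big)-\frac1p & p<\infty,\\[1ex] \frac{1}{q_i+q_j+1} & p=\infty.\end{cases} \]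
   Context: For $x\in\mathbb R^n$, $\|x\|_p=(\sum_{i=1}^n|x_i|^p)^{1/p}$ for $p<\infty$ and $\|x\|_\infty=\max_i|x_i|$; $\mathbb B_p^n=\{x\in\mathbb R^n:\|x\|_p\le1\}$. For $r,s\ge0$: $M_p(r)=\frac{p^{r/p}}{r+1}\frac{\Gamma(1+\frac{r+1}{p})}{\Gamma(1+\frac1p)}$ for $p<\infty$, $M_\infty(r)=\frac1{r+1}$, and $C_p(r,s)=M_p(r+s)-M_p(r)M_p(s)$, with the conventions $M_\infty(\infty)=0$, $C_\infty(\infty,\infty)=C_\infty(\infty,q)=0$ (used in the first formula for $c_{ij}$ when $p=\infty$). $\xrightarrow{d}$ denotes convergence in distribution. *)

theory Defs
  imports "HOL-Probability.Probability"
begin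

text \<open>Exponents p in [1,\<infinity>] are represented as extended reals.  Vectors in R^n are
  functions nat => real, only the coordinates 0..n-1 being relevant; R^n carries the
  product Lebesgue measure PiM {..<n} (\<lambda>_. lborel).\<close>

definition lp_norm :: "nat \<Rightarrow> ereal \<Rightarrow> (nat \<Rightarrow> real) \<Rightarrow> real" where
  "lp_norm n p x =
     (if p = \<infinity> then Max (insert 0 ((\<lambda>i. \<bar>x i\<bar>) ` {..<n}))
      else (\<Sum>i<n. \<bar>x i\<bar> powr real_of_ereal p) powr (1 / real_of_ereal p))"

definition lp_ball :: "nat \<Rightarrow> ereal \<Rightarrow> (nat \<Rightarrow> real) set" where
  "lp_ball n p = {x \<in> space (PiM {..<n} (\<lambda>_. lborel)). lp_norm n p x \<le> 1}"

definition unif_lp_ball :: "nat \<Rightarrow> ereal \<Rightarrow> (nat \<Rightarrow> real) measure" where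
  "unif_lp_ball n p = uniform_measure (PiM {..<n} (\<lambda>_. lborel)) (lp_ball n p)"

definition inv_exp :: "ereal \<Rightarrow> real" where
  "inv_exp p = (if p = \<infinity> then 0 else 1 / real_of_ereal p)"

definition Mp :: "ereal \<Rightarrow> real \<Rightarrow> real" where
  "Mp p r = (if p = \<infinity> then 1 / (r + 1)
     else (let p' = real_of_ereal p in
       p' powr (r / p') / (r + 1) * Gamma (1 + (r + 1) / p') / Gamma (1 + 1 / p')))"

definition Cp :: "ereal \<Rightarrow> real \<Rightarrow> real \<Rightarrow> real" where
  "Cp p r s = Mp p (r + s) - Mp p r * Mp p s"

text \<open>First formula for c_ij, with the conventions M_\<infinity>(\<infinity>)=0, C_\<infinity>(\<infinity>,\<infinity>)=C_\<infinity>(\<infinity>,q)=0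
  (so the terms involving C_p(p,.) vanish for p = \<infinity>).\<close>
definition cov1 :: "ereal \<Rightarrow> real \<Rightarrow> real \<Rightarrow> real" where
  "cov1 p qi qj =
     Cp p qi qj / (qi * qj * Mp p qi * Mp p qj)
     + (if p = \<infinity> then 0 else Cp p (real_of_ereal p) (real_of_ereal p) / (real_of_ereal p)^2)
     - (if p = \<infinity> then 0 else
          (1 / real_of_ereal p) * (Cp p qi (real_of_ereal p) / (qi * Mp p qi)
                                  + Cp p qj (real_of_ereal p) / (qj * Mp p qj)))"

definition cov2 :: "ereal \<Rightarrow> real \<Rightarrow> real \<Rightarrow> real" where
  "cov2 p qi qj =
     (if p = \<infinity> then 1 / (qi + qj + 1)
      else (let p' = real_of_ereal p in
        1 / (qi * qj) * (Gamma (1 / p') * Gamma ((qi + qj + 1) / p')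
                          / (Gamma ((qi + 1) / p') * Gamma ((qj + 1) / p')) - 1) - 1 / p'))"

text \<open>Centered Gaussian probability measure on R^d with covariance matrix C
  (possibly degenerate), characterised by its characteristic function.\<close>
definition centered_gaussian :: "real^'d^'d \<Rightarrow> (real^'d) measure \<Rightarrow> bool" where
  "centered_gaussian C N \<longleftrightarrow> prob_space N \<and> sets N = sets borel \<and>
     (\<forall>t. (CLINT x|N. cis (t \<bullet> x)) = complex_of_real (exp (- (t \<bullet> (C *v t)) / 2)))"

definition weak_conv_vec :: "(nat \<Rightarrow> (real^'d) measure) \<Rightarrow> (real^'d) measure \<Rightarrow> bool" where
  "weak_conv_vec \<mu> \<nu> \<longleftrightarrow>
     (\<forall>f :: real^'d \<Rightarrow> real. continuous_on UNIV f \<and> bounded (range f) \<longrightarrow>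
        (\<lambda>n. \<integral>x. f x \<partial>\<mu> n) \<longlonglongrightarrow> (\<integral>x. f x \<partial>\<nu>))"

end

theory Submission
  imports Defs
begin

text \<open>Idea: for \<open>p < \<infinity>\<close> let \<open>Y\<close> have i.i.d. coordinates with density proportional to
  \<open>exp (- \<bar>y\<bar>\<^sup>p / p)\<close>. Then \<open>Y = R Z\<close> in law, with \<open>R > 0\<close> independent of the uniform point \<open>Z\<close>
  of the ball. Taking logarithms of norms makes \<open>R\<close> an additive term, so the characteristic function of the
  vector of log norms of \<open>Y\<close> is the product of that of \<open>Z\<close> and that of \<open>log R\<close>. The central limit
  theorem gives the limit for \<open>Y\<close>. The exponent \<open>p\<close> itself gives the limit for \<open>R\<close>, because the
  \<open>p\<close>-norm of \<open>Z\<close> is \<open>1 - O(1/n)\<close>. Dividing the characteristic functions yields the limit for \<open>Z\<close>,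
  and \<open>C\<^sub>p(q,p) = q M\<^sub>p(q)\<close> identifies the covariance. For \<open>p = \<infinity>\<close> the coordinates of \<open>Z\<close> are
  already independent. Levy's continuity theorem turns the limit of characteristic functions into weak convergence, and the
  map \<open>x \<mapsto> sqrt n (exp (x / sqrt n) - 1)\<close>, which tends to the identity, undoes the logarithm.\<close>

text \<open>The radius shifts all logarithmic coordinates by the same amount, so its characteristic
  function enters only at the sum of the coordinates of \<open>t\<close>. In the limit it adds
  \<open>1/p\<close> to every entry of the covariance, and removing it leaves \<open>A - 1/p\<close>
  entrywise, with \<open>A\<close> the covariance for i.i.d. coordinates. Because the argument
  divides limits, neither the limit of the radial law nor the volume of the ball has to be computed
  by hand; the division is sound since a Gaussian characteristic function never vanishes. That
  \<open>A - 1/p\<close> is positive semidefinite is not visible from the formula. It is read off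
  from the limit: characteristic functions have modulus at most 1. The limit law may be degenerate,
  so it is constructed as a linear image of independent standard normals and not by a
  density.\<close>

subsection \<open>Gaussian vectors\<close>

lemma psd_null_vector:
  fixes b :: "'a::real_vector \<Rightarrow> 'a \<Rightarrow> real"
  assumes "bilinear b" and sym: "\<And>x y. b x y = b y x" and psd: "\<And>x. 0 \<le> b x x" and "b u u = 0"
  shows "b u y = 0"
proof (rule ccontr)
  assume nz: "b u y \<noteq> 0"
  \<comment> \<open>As \<open>b u u = 0\<close>, the form is affine in \<open>s\<close> along
    \<open>y + s u\<close>. A nonzero slope would make it negative somewhere; this \<open>s\<close>
    yields the value -1.\<close>
  define s where "s = - (b y y + 1) / (2 * b u y)"
  have "b (y + s *\<^sub>R u) (y + s *\<^sub>R u) = b y y + 2 * s * b u y"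
    using assms(1) sym[of y u] \<open>b u u = 0\<close>
    by (simp add: bilinear_ladd bilinear_radd bilinear_lmul bilinear_rmul)
  also have "2 * s * b u y = - (b y y + 1)" using nz by (simp add: s_def)
  finally show False using psd[of "y + s *\<^sub>R u"] by simp
qed

text \<open>Lagrange's completion of squares, one basis vector at a time: \<open>S\<close> contains
  the basis vectors that are not yet known to lie in the radical of \<open>b\<close>.\<close>

lemma psd_sum_of_squares_aux:
  fixes b :: "'a::euclidean_space \<Rightarrow> 'a \<Rightarrow> real"
  assumes "finite S" "S \<subseteq> Basis" "bilinear b" "\<And>x y. b x y = b y x" "\<And>x. 0 \<le> b x x"
    and "\<And>u y. u \<in> Basis - S \<Longrightarrow> b u y = 0"
  shows "\<exists>(m::nat) F. (\<forall>k<m. linear (F k)) \<and> (\<forall>x. b x x = (\<Sum>k<m. (F k x)\<^sup>2))"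
  using assms
proof (induction S arbitrary: b rule: finite_induct)
  case empty
  have "b x x = 0" for x
  proof -
    have "linear (\<lambda>y. b y x)" using empty.prems(2) by (simp add: bilinear_def)
    then have "(\<lambda>y. b y x) = (\<lambda>_. 0)"
      by (rule linear_eq_stdbasis[OF _ linear_zero]) (simp add: empty.prems(5))
    then show ?thesis by (rule fun_cong)
  qed
  then show ?case by (intro exI[of _ 0]) auto
next
  case (insert i S)
  show ?case
  proof (cases "b i i = 0")
    case True
    have "b i y = 0" for y
      by (rule psd_null_vector[OF insert.prems(2,3,4) True])
    then have "b u y = 0" if "u \<in> Basis - S" for u y
      using insert.prems(5)[of u y] that by (cases "u = i") auto
    then show ?thesis using insert.prems(1) by (intro insert.IH[of b] insert.prems(2-4)) auto
  next
    case False
    then have pos: "0 < b i i" using insert.prems(4)[of i] by simp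
    define r where "r = 1 / b i i"
    have r: "r * b i i = 1" "r \<ge> 0" using pos by (simp_all add: r_def)
    \<comment> \<open>Removing the square belonging to \<open>i\<close> puts \<open>i\<close> into
      the radical of \<open>c\<close>, and basis vectors in the radical of \<open>b\<close> stay
      there.\<close>
    define c where "c x y = b x y - r * b x i * b y i" for x y
    have badd: "b (x + y) z = b x z + b y z" "b z (x + y) = b z x + b z y"
      and bscale: "b (a *\<^sub>R x) z = a * b x z" "b z (a *\<^sub>R x) = a * b z x" for x y z a
      using insert.prems(2) by (simp_all add: bilinear_ladd bilinear_radd bilinear_lmul bilinear_rmul)
    have bil: "bilinear c"
      unfolding bilinear_def by (intro conjI allI linearI; simp add: c_def badd bscale algebra_simps)
    have csym: "c x y = c y x" for x y
      using insert.prems(3)[of x y] by (simp add: c_def)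
    have cpsd: "0 \<le> c x x" for x
    proof -
      \<comment> \<open>\<open>c x x\<close> is the value of \<open>b\<close> at the component of
        \<open>x\<close> that is \<open>b\<close>-orthogonal to \<open>i\<close>, hence
        nonnegative.\<close>
      have "b (x + (- (r * b x i)) *\<^sub>R i) (x + (- (r * b x i)) *\<^sub>R i) = b x x - 2 * r * (b x i)\<^sup>2 + r * (b x i)\<^sup>2 * (r * b i i)"
        unfolding badd bscale insert.prems(3)[of i x] by (simp add: power2_eq_square algebra_simps)
      also have "\<dots> = c x x" by (simp add: r c_def power2_eq_square)
      finally show ?thesis using insert.prems(4) by metis
    qed
    have "c u y = 0" if "u \<in> Basis - S" for u y
    proof (cases "u = i")
      case True
      then show ?thesis using r insert.prems(3)[of i y] by (simp add: c_def mult.assoc mult.left_commute)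
    next
      case False
      then have "b u z = 0" for z using insert.prems(5) that by auto
      then show ?thesis by (simp add: c_def)
    qed
    then obtain m F where F: "\<And>k. k < m \<Longrightarrow> linear (F k)" "\<And>x. c x x = (\<Sum>k<(m::nat). (F k x)\<^sup>2)"
      using insert.IH[OF _ bil csym cpsd] insert.prems(1) by auto
    define G where "G = F(m := \<lambda>x. sqrt r * b x i)"
    have "linear (G k)" if "k < Suc m" for k
    proof (cases "k = m")
      case True
      then show ?thesis
        by (auto intro!: linearI simp: G_def badd bscale distrib_left)
    next
      case False
      then show ?thesis using that F(1)[of k] by (simp add: G_def)
    qed
    moreover have "b x x = (\<Sum>k<Suc m. (G k x)\<^sup>2)" for x
    proof -
      have "(\<Sum>k<Suc m. (G k x)\<^sup>2) = c x x + (sqrt r * b x i)\<^sup>2"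
        by (simp add: G_def F(2))
      also have "\<dots> = b x x" using r by (simp add: c_def power_mult_distrib power2_eq_square)
      finally show ?thesis by simp
    qed
    ultimately show ?thesis by (intro exI[of _ "Suc m"] exI[of _ G] conjI allI impI) assumption
  qed
qed

text \<open>Each linear functional is an inner product with a vector. For a covariance form the
  \<open>v k\<close> are the columns of a square root of the matrix.\<close>

lemma psd_sum_of_squares:
  fixes b :: "'a::euclidean_space \<Rightarrow> 'a \<Rightarrow> real"
  assumes "bilinear b" "\<And>x y. b x y = b y x" "\<And>x. 0 \<le> b x x"
  shows "\<exists>(m::nat) v. \<forall>x. b x x = (\<Sum>k<m. (x \<bullet> v k)\<^sup>2)"
proof -
  have "\<exists>(m::nat) F. (\<forall>k<m. linear (F k)) \<and> (\<forall>x. b x x = (\<Sum>k<m. (F k x)\<^sup>2))"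
    by (rule psd_sum_of_squares_aux[OF finite_Basis order_refl assms]) simp
  then obtain m F where "(\<forall>k<m. linear (F k)) \<and> (\<forall>x. b x x = (\<Sum>k<(m::nat). (F k x)\<^sup>2))"
    by (elim exE)
  then have F: "k < m \<Longrightarrow> linear (F k)" "b x x = (\<Sum>k<m. (F k x)\<^sup>2)" for k x
    by simp_all
  have F_inner: "F k x = x \<bullet> (\<Sum>u\<in>Basis. F k u *\<^sub>R u)" if "k < m" for k x
  proof -
    have "F k x = F k (\<Sum>u\<in>Basis. (x \<bullet> u) *\<^sub>R u)" by (simp add: euclidean_representation)
    also have "\<dots> = (\<Sum>u\<in>Basis. (x \<bullet> u) * F k u)"
      using F(1)[OF that] by (simp add: linear_sum linear_scale)
    finally show ?thesis by (simp add: inner_sum_right mult.commute)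
  qed
  have "(\<Sum>k<m. (F k x)\<^sup>2) = (\<Sum>k<m. (x \<bullet> (\<Sum>u\<in>Basis. F k u *\<^sub>R u))\<^sup>2)" for x
    by (intro sum.cong refl arg_cong[where f = "\<lambda>y. y\<^sup>2"] F_inner) simp
  then have "\<forall>x. b x x = (\<Sum>k<m. (x \<bullet> (\<Sum>u\<in>Basis. F k u *\<^sub>R u))\<^sup>2)"
    by (intro allI trans[OF F(2)])
  then show ?thesis
    by (rule exI[of _ m, OF exI[of _ "\<lambda>k. \<Sum>u\<in>Basis. F k u *\<^sub>R u"]])
qed

lemma borel_measurable_cis[measurable (raw)]:
  "f \<in> borel_measurable M \<Longrightarrow> (\<lambda>x. cis (f x)) \<in> borel_measurable M"
  by (rule measurable_compose[OF _ borel_measurable_continuous_onI[OF continuous_on_cis[OF continuous_on_id]]])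

lemma integral_PiM_cis_sum:
  assumes "prob_space G" "finite I" and [measurable]: "\<And>i. i \<in> I \<Longrightarrow> f i \<in> borel_measurable G"
  shows "(CLINT x|PiM I (\<lambda>_. G). cis (\<Sum>i\<in>I. f i (x i))) = (\<Prod>i\<in>I. CLINT x|G. cis (f i x))"
proof -
  interpret G: prob_space G by fact
  interpret product_sigma_finite "\<lambda>_. G" ..
  have "(CLINT x|PiM I (\<lambda>_. G). cis (\<Sum>i\<in>I. f i (x i))) = (CLINT x|PiM I (\<lambda>_. G). (\<Prod>i\<in>I. cis (f i (x i))))"
    by (simp add: cis_conv_exp exp_sum sum_distrib_left assms)
  also have "\<dots> = (\<Prod>i\<in>I. CLINT x|G. cis (f i x))"
    using assms(2) by (intro product_integral_prod) (auto intro!: G.integrable_const_bound[where B=1])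
  finally show ?thesis .
qed

text \<open>Independent standard normal coefficients along the vectors \<open>v k\<close> of a
  decomposition into squares give a vector with covariance \<open>C\<close>. No inverse of
  \<open>C\<close> occurs, so degenerate matrices are covered.\<close>

lemma ex_centered_gaussian:
  fixes C :: "real^'d^'d"
  assumes sym: "\<And>i j. C $ i $ j = C $ j $ i" and psd: "\<And>t. 0 \<le> t \<bullet> (C *v t)"
  shows "\<exists>N. centered_gaussian C N"
proof -
  have "bilinear (\<lambda>x y. x \<bullet> (C *v y))"
    by (auto simp: bilinear_def inner_add_left inner_add_right matrix_vector_right_distrib
        matrix_vector_mult_scaleR intro!: linearI)
  moreover have "x \<bullet> (C *v y) = y \<bullet> (C *v x)" for x y
  proof -
    have "transpose C = C" using sym by (simp add: transpose_def vec_eq_iff)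
    then have "x \<bullet> (C *v y) = (C *v x) \<bullet> y"
      using dot_lmul_matrix[of x C y] transpose_matrix_vector[of C x] by simp
    then show ?thesis by (simp add: inner_commute)
  qed
  ultimately have "\<exists>(m::nat) v. \<forall>t. t \<bullet> (C *v t) = (\<Sum>k<m. (t \<bullet> v k)\<^sup>2)"
    by (rule psd_sum_of_squares[OF _ _ psd])
  then obtain m :: nat and v where v: "\<forall>t. t \<bullet> (C *v t) = (\<Sum>k<m. (t \<bullet> v k)\<^sup>2)"
    by (elim exE)
  define P where "P = PiM {..<m} (\<lambda>_. std_normal_distribution)"
  interpret S: real_distribution std_normal_distribution by (rule real_dist_normal_dist)
  interpret P: prob_space P unfolding P_def by (intro prob_space_PiM S.prob_space_axioms)
  define T where "T \<omega> = (\<Sum>k<m. \<omega> k *\<^sub>R v k)" for \<omega>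
  have comp[measurable]: "(\<lambda>\<omega>. \<omega> k) \<in> borel_measurable P" if "k \<in> {..<m}" for k
    using measurable_component_singleton[OF that, of "\<lambda>_. std_normal_distribution"]
    by (simp add: P_def cong: measurable_cong_sets)
  have [measurable]: "T \<in> P \<rightarrow>\<^sub>M borel" unfolding T_def by measurable
  have "(CLINT x|distr P borel T. cis (t \<bullet> x)) = complex_of_real (exp (- (t \<bullet> (C *v t)) / 2))" for t
  proof -
    have "(CLINT x|distr P borel T. cis (t \<bullet> x)) = (CLINT \<omega>|P. cis (t \<bullet> T \<omega>))"
      by (intro integral_distr) (auto simp: cis_conv_exp)
    also have "\<dots> = (CLINT \<omega>|P. cis (\<Sum>k<m. (t \<bullet> v k) * \<omega> k))"
      by (simp add: T_def inner_sum_right mult.commute)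
    also have "\<dots> = (\<Prod>k<m. CLINT x|std_normal_distribution. cis ((t \<bullet> v k) * x))"
      unfolding P_def by (intro integral_PiM_cis_sum S.prob_space_axioms) auto
    also have "\<dots> = (\<Prod>k<m. char std_normal_distribution (t \<bullet> v k))"
      by (simp add: char_def cis_conv_exp)
    also have "\<dots> = complex_of_real (exp (\<Sum>k<m. - (t \<bullet> v k)\<^sup>2 / 2))"
      by (simp only: char_std_normal_distribution exp_sum[OF finite_lessThan] of_real_prod)
    finally show ?thesis by (simp add: v sum_negf sum_divide_distrib)
  qed
  then have "centered_gaussian C (distr P borel T)"
    by (auto simp: centered_gaussian_def intro!: P.prob_space_distr)
  then show ?thesis by blast
qed

subsection \<open>Weak convergence of random vectors\<close>

lemma measure_norm_tail_tendsto_0: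
  fixes \<nu> :: "'a::euclidean_space measure"
  assumes "finite_measure \<nu>" and \<nu>: "sets \<nu> = sets borel"
  shows "(\<lambda>k::nat. measure \<nu> {x. real k < norm x}) \<longlonglongrightarrow> 0"
proof -
  interpret finite_measure \<nu> by fact
  have "(\<lambda>k::nat. measure \<nu> {x. real k < norm x}) \<longlonglongrightarrow> measure \<nu> (\<Inter>k::nat. {x. real k < norm x})"
    by (rule finite_Lim_measure_decseq) (auto simp: \<nu> decseq_def)
  moreover have "(\<Inter>k::nat. {x::'a. real k < norm x}) = {}"
    using reals_Archimedean2[of "norm _"] by (fastforce dest: less_asym)
  ultimately show ?thesis by simp
qed

lemma integrable_cis_inner:
  fixes t :: "'a::euclidean_space"
  assumes "prob_space M" and [measurable_cong]: "sets M = sets borel"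
  shows "integrable M (\<lambda>x. cis (t \<bullet> x))"
proof -
  interpret prob_space M by fact
  show ?thesis by (rule integrable_const_bound[where B = 1]) auto
qed

text \<open>A continuous ramp lies between the indicators of the tails beyond \<open>k + 1\<close>
  and beyond \<open>k\<close>. So a small tail of the limit passes to almost all
  \<open>\<mu> n\<close> at the price of one unit of radius. Stated for any Euclidean space because
  it serves both real marginals and vectors.\<close>

lemma weak_limit_tight:
  fixes \<mu> :: "nat \<Rightarrow> 'a::euclidean_space measure"
  assumes \<mu>: "\<And>n. prob_space (\<mu> n)" "\<And>n. sets (\<mu> n) = sets borel"
    and \<nu>: "prob_space \<nu>" "sets \<nu> = sets borel"
    and conv: "\<And>f :: 'a \<Rightarrow> real. continuous_on UNIV f \<Longrightarrow> bounded (range f) \<Longrightarrow>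
      (\<lambda>n. \<integral>x. f x \<partial>\<mu> n) \<longlonglongrightarrow> (\<integral>x. f x \<partial>\<nu>)"
    and "e > 0"
  shows "\<exists>K. \<forall>\<^sub>F n in sequentially. measure (\<mu> n) {x. K < norm x} < e"
proof -
  note [measurable_cong] = \<mu>(2) \<nu>(2)
  interpret \<nu>: prob_space \<nu> by fact
  have "(\<lambda>k::nat. measure \<nu> {x. real k < norm x}) \<longlonglongrightarrow> 0"
    using \<nu> by (intro measure_norm_tail_tendsto_0) (auto intro: prob_space.finite_measure)
  then have "\<forall>\<^sub>F k in sequentially. measure \<nu> {x. real k < norm x} < e"
    using \<open>e > 0\<close> by (auto dest: order_tendstoD(2))
  then obtain k :: nat where k: "measure \<nu> {x. real k < norm x} < e"
    by (auto simp: eventually_sequentially)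
  define f where "f x = min 1 (max 0 (norm x - real k))" for x :: 'a
  have cont: "continuous_on UNIV f" unfolding f_def by (intro continuous_intros)
  then have [measurable]: "f \<in> borel_measurable borel" by (rule borel_measurable_continuous_onI)
  have f01: "0 \<le> f x" "f x \<le> 1" for x by (auto simp: f_def)
  have bd: "bounded (range f)" unfolding bounded_iff using f01 by (intro exI[of _ 1]) auto
  have "(\<integral>x. f x \<partial>\<nu>) \<le> (\<integral>x. indicator {x. real k < norm x} x \<partial>\<nu>)"
    by (intro integral_mono \<nu>.integrable_const_bound[where B = 1])
       (auto simp: f01 indicator_def f_def)
  also have "\<dots> < e" using k by (simp add: \<nu>(2))
  finally have "\<forall>\<^sub>F n in sequentially. (\<integral>x. f x \<partial>\<mu> n) < e"
    using conv[OF cont bd] by (auto dest: order_tendstoD(2))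
  then have "\<forall>\<^sub>F n in sequentially. measure (\<mu> n) {x. real k + 1 < norm x} < e"
  proof eventually_elim
    case (elim n)
    interpret M: prob_space "\<mu> n" by (rule \<mu>)
    have "measure (\<mu> n) {x. real k + 1 < norm x} = (\<integral>x. indicator {x. real k + 1 < norm x} x \<partial>\<mu> n)"
      by (simp add: \<mu>(2))
    also have "\<dots> \<le> (\<integral>x. f x \<partial>\<mu> n)"
      by (intro integral_mono M.integrable_const_bound[where B = 1])
         (auto simp: f01 indicator_def f_def)
    finally show ?case using elim by simp
  qed
  then show ?thesis by blast
qed

text \<open>The linear span of the real and imaginary parts of \<open>cis (t \<bullet> x)\<close>.
  Convergence of characteristic functions gives convergence of integrals for these functions
  directly, which is why products are not among the generators.\<close>

inductive trig_polynomial :: "('a::real_inner \<Rightarrow> real) \<Rightarrow> bool" where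
  cos: "trig_polynomial (\<lambda>x. cos (t \<bullet> x))"
| sin: "trig_polynomial (\<lambda>x. sin (t \<bullet> x))"
| scale: "trig_polynomial f \<Longrightarrow> trig_polynomial (\<lambda>x. c * f x)"
| add: "trig_polynomial f \<Longrightarrow> trig_polynomial g \<Longrightarrow> trig_polynomial (\<lambda>x. f x + g x)"

lemma trig_polynomial_const: "trig_polynomial (\<lambda>_. c)"
  using trig_polynomial.scale[OF trig_polynomial.cos[of 0], of c] by simp

lemma trig_polynomial_diff:
  "trig_polynomial f \<Longrightarrow> trig_polynomial g \<Longrightarrow> trig_polynomial (\<lambda>x. f x - g x)"
  using trig_polynomial.add[OF _ trig_polynomial.scale, of f g "-1"] by simp

text \<open>The product-to-sum formulas keep products inside the linear span, which makes it an
  algebra as Stone-Weierstrass demands.\<close>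

lemma trig_polynomial_mult:
  assumes "trig_polynomial f" "trig_polynomial g"
  shows "trig_polynomial (\<lambda>x. f x * g x)"
proof -
  have cos_cos: "trig_polynomial (\<lambda>x. cos (s \<bullet> x) * cos (t \<bullet> x))" 
   and sin_sin: "trig_polynomial (\<lambda>x. sin (s \<bullet> x) * sin (t \<bullet> x))"
   and sin_cos: "trig_polynomial (\<lambda>x. sin (s \<bullet> x) * cos (t \<bullet> x))" for s t :: 'a
  proof -
    have c: "trig_polynomial (\<lambda>x. (1/2) * cos ((s - t) \<bullet> x))" "trig_polynomial (\<lambda>x. (1/2) * cos ((s + t) \<bullet> x))"
      and s: "trig_polynomial (\<lambda>x. (1/2) * sin ((s + t) \<bullet> x))" "trig_polynomial (\<lambda>x. (1/2) * sin ((s - t) \<bullet> x))"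
      by (intro trig_polynomial.intros)+
    show "trig_polynomial (\<lambda>x. cos (s \<bullet> x) * cos (t \<bullet> x))"
      using trig_polynomial.add[OF c] by (simp add: cos_times_cos inner_add_left inner_diff_left field_simps)
    show "trig_polynomial (\<lambda>x. sin (s \<bullet> x) * sin (t \<bullet> x))"
      using trig_polynomial_diff[OF c] by (simp add: sin_times_sin inner_add_left inner_diff_left field_simps)
    show "trig_polynomial (\<lambda>x. sin (s \<bullet> x) * cos (t \<bullet> x))"
      using trig_polynomial.add[OF s]
      by (simp only: sin_times_cos inner_add_left inner_diff_left add_divide_distrib times_divide_eq_left mult_1)
  qed
  \<comment> \<open>Induction on the second factor with an arbitrary first factor \<open>h\<close>.
    The outer induction then only has to treat \<open>h\<close> a single cosine or sine.\<close>
  have basic: "trig_polynomial (\<lambda>x. h x * g x)"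
    if h: "\<And>t. trig_polynomial (\<lambda>x. h x * cos (t \<bullet> x))" "\<And>t. trig_polynomial (\<lambda>x. h x * sin (t \<bullet> x))" for h
    using assms(2)
  proof induction
    case (scale f c)
    then show ?case using trig_polynomial.scale[OF scale.IH, of c] by (simp add: ac_simps)
  next
    case (add f g)
    then show ?case using trig_polynomial.add[OF add.IH] by (simp add: distrib_left)
  qed (fact h)+
  show ?thesis
    using assms(1)
  proof induction
    case (cos t)
    show ?case using cos_cos sin_cos by (intro basic) (auto simp: mult.commute)
  next
    case (sin t)
    show ?case using sin_sin sin_cos by (intro basic)
  next
    case (scale f c)
    then show ?case using trig_polynomial.scale[OF scale.IH, of c] by (simp add: ac_simps)
  next
    case (add f h)
    then show ?case using trig_polynomial.add[OF add.IH] by (simp add: distrib_right)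
  qed
qed

lemma trig_polynomial_compose:
  fixes Q :: "real \<Rightarrow> real"
  assumes "real_polynomial_function Q" "trig_polynomial P"
  shows "trig_polynomial (\<lambda>x. Q (P x))"
  using assms(1)
proof induction
  case (linear f)
  then obtain c where "f = (\<lambda>x. x * c)" by (auto simp: real_bounded_linear)
  then show ?case using trig_polynomial.scale[OF assms(2), of c] by (simp add: mult.commute)
qed (auto intro: trig_polynomial_const trig_polynomial.add trig_polynomial_mult)

lemma trig_polynomial_continuous: "trig_polynomial f \<Longrightarrow> continuous_on S f"
  by (induction rule: trig_polynomial.induct) (auto intro!: continuous_intros)

lemma trig_polynomial_bounded: "trig_polynomial f \<Longrightarrow> \<exists>M. \<forall>x. \<bar>f x\<bar> \<le> M"
proof (induction rule: trig_polynomial.induct)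
  case (cos t)
  show ?case by (intro exI[of _ 1]) auto
next
  case (sin t)
  show ?case by (intro exI[of _ 1]) auto
next
  case (scale f c)
  then obtain M where "\<forall>x. \<bar>f x\<bar> \<le> M" by blast
  then show ?case by (intro exI[of _ "\<bar>c\<bar> * M"]) (auto simp: abs_mult intro: mult_left_mono)
next
  case (add f g)
  then obtain M N where "\<forall>x. \<bar>f x\<bar> \<le> M" "\<forall>x. \<bar>g x\<bar> \<le> N" by blast
  then have "\<bar>f x + g x\<bar> \<le> M + N" for x
    by (intro order_trans[OF abs_triangle_ineq] add_mono) auto
  then show ?case by blast
qed

text \<open>An approximation on the ball alone gives no control outside it; composing it with a
  polynomial close to the truncation at \<open>\<plusminus>B\<close> restores a global bound without leaving
  the algebra.\<close>

lemma trig_polynomial_approx: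
  fixes f :: "'a::euclidean_space \<Rightarrow> real"
  assumes f: "continuous_on (cball 0 K) f" and e: "e > 0" and B: "\<And>x. \<bar>f x\<bar> \<le> B"
  obtains g where "trig_polynomial g" "\<And>x. \<bar>g x\<bar> \<le> B + e" "\<And>x. x \<in> cball 0 K \<Longrightarrow> \<bar>f x - g x\<bar> < e"
proof -
  define S :: "'a set" where "S = cball 0 K"
  interpret R: function_ring_on "Collect trig_polynomial" S
  proof
    fix x y assume xy: "x \<in> S" "y \<in> S" "x \<noteq> y"
    then obtain b where b: "b \<in> Basis" "x \<bullet> b \<noteq> y \<bullet> b"
      using euclidean_eq_iff by blast
    have K: "\<bar>x \<bullet> b\<bar> \<le> K" "\<bar>y \<bullet> b\<bar> \<le> K"
      using xy Basis_le_norm[OF b(1)] by (force simp: S_def intro: order_trans)+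
    then have "K > 0" using b(2) by (cases "K > 0") auto
    \<comment> \<open>The frequency \<open>1 / K\<close> brings both arguments into
      \<open>[-1, 1]\<close>, where sine is injective, so \<open>h\<close> separates
      \<open>x\<close> from \<open>y\<close>.\<close>
    define h where "h z = sin (((1 / K) *\<^sub>R b) \<bullet> z)" for z
    have "h x \<noteq> h y"
    proof
      assume "h x = h y"
      then have "sin ((x \<bullet> b) / K) = sin ((y \<bullet> b) / K)" by (simp add: h_def inner_commute)
      moreover have "\<bar>(x \<bullet> b) / K\<bar> \<le> 1" "\<bar>(y \<bullet> b) / K\<bar> \<le> 1" using K \<open>K > 0\<close> by simp_all
      then have "- (pi / 2) \<le> (x \<bullet> b) / K" "(x \<bullet> b) / K \<le> pi / 2"
        "- (pi / 2) \<le> (y \<bullet> b) / K" "(y \<bullet> b) / K \<le> pi / 2"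
        using pi_gt3 by linarith+
      ultimately have "(x \<bullet> b) / K = (y \<bullet> b) / K" by (simp only: sin_inj_pi)
      then show False using b(2) \<open>K > 0\<close> by simp
    qed
    moreover have "trig_polynomial h" unfolding h_def by (rule trig_polynomial.sin)
    ultimately show "\<exists>f\<in>Collect trig_polynomial. f x \<noteq> f y" by blast
  qed (auto simp: S_def intro: trig_polynomial_continuous trig_polynomial.add trig_polynomial_mult trig_polynomial_const)
  obtain P where P: "trig_polynomial P" "\<And>x. x \<in> S \<Longrightarrow> \<bar>f x - P x\<bar> < e / 2"
    using R.Stone_Weierstrass_basic[of f "e / 2"] f e by (auto simp: S_def)
  obtain M where M: "\<And>x. \<bar>P x\<bar> \<le> M" using trig_polynomial_bounded[OF P(1)] by blast
  define clamp where "clamp y = max (- B) (min B y)" for y :: real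
  have "continuous_on {-M..M} clamp" unfolding clamp_def by (intro continuous_intros)
  then obtain Q where Q: "real_polynomial_function Q" "\<And>y. y \<in> {-M..M} \<Longrightarrow> \<bar>clamp y - Q y\<bar> < e / 2"
    using Stone_Weierstrass_real_polynomial_function[of "{-M..M}" clamp "e / 2"] e by auto
  have B0: "0 \<le> B" using B[of 0] by linarith
  have PM: "P x \<in> {-M..M}" for x using M[of x] by (auto simp: abs_le_iff)
  show thesis
  proof (rule that[OF trig_polynomial_compose[OF Q(1) P(1)]])
    fix x
    have "\<bar>clamp (P x)\<bar> \<le> B" using B0 by (auto simp: clamp_def)
    then show "\<bar>Q (P x)\<bar> \<le> B + e" using Q(2)[OF PM[of x]] e by linarith
  next
    fix x :: 'a assume "x \<in> cball 0 K"
    then have "\<bar>f x - P x\<bar> < e / 2" by (intro P(2)) (simp add: S_def)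
    \<comment> \<open>Truncation fixes \<open>f x\<close>, which lies in \<open>[-B, B]\<close>, and
      does not increase distances.\<close>
    moreover have "\<bar>f x - clamp (P x)\<bar> \<le> \<bar>f x - P x\<bar>" using B[of x] by (auto simp: clamp_def)
    ultimately show "\<bar>f x - Q (P x)\<bar> < e" using Q(2)[OF PM[of x]] by linarith
  qed
qed


text \<open>\<open>A\<close> is an exceptional set of small measure, in the applications a tail:
  there only the crude bounds on \<open>f\<close> and \<open>g\<close> are available.\<close>

lemma integral_diff_le:
  assumes "prob_space M" and [measurable]: "f \<in> borel_measurable M" "g \<in> borel_measurable M" "A \<in> sets M"
    and f: "\<And>x. \<bar>f x\<bar> \<le> B" and g: "\<And>x. \<bar>g x\<bar> \<le> B'"
    and close: "\<And>x. x \<in> space M - A \<Longrightarrow> \<bar>f x - g x\<bar> \<le> e" and "e \<ge> 0"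
  shows "\<bar>(\<integral>x. f x \<partial>M) - (\<integral>x. g x \<partial>M)\<bar> \<le> e + (B + B') * measure M A"
proof -
  interpret prob_space M by fact
  have int: "integrable M f" "integrable M g"
    using integrable_const_bound[of f B] integrable_const_bound[of g B'] f g by auto
  have "\<bar>(\<integral>x. f x \<partial>M) - (\<integral>x. g x \<partial>M)\<bar> = \<bar>\<integral>x. f x - g x \<partial>M\<bar>" using int by simp
  also have "\<dots> \<le> (\<integral>x. e * indicator (space M - A) x + (B + B') * indicator A x \<partial>M)"
  proof (rule order_trans[OF integral_abs_bound], rule integral_mono)
    fix x assume "x \<in> space M"
    then show "\<bar>f x - g x\<bar> \<le> e * indicator (space M - A) x + (B + B') * indicator A x"
      using close[of x] f[of x] g[of x] by (cases "x \<in> A") (auto simp: indicator_def)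
  qed (use int in \<open>auto simp: emeasure_eq_measure\<close>)
  also have "\<dots> = e * measure M (space M - A) + (B + B') * measure M A"
    by (subst Bochner_Integration.integral_add) (auto simp: emeasure_eq_measure)
  also have "\<dots> \<le> e + (B + B') * measure M A"
    using mult_left_mono[OF prob_le_1[of "space M - A"] \<open>e \<ge> 0\<close>] by simp
  finally show ?thesis .
qed

text \<open>Since the limit law is given, no compactness of families of measures is needed. The
  one-dimensional continuity theorem for each coordinate yields tightness, and on a large ball a
  test function is replaced by a trigonometric polynomial, whose integrals converge by
  hypothesis.\<close>

theorem levy_continuity_vec:
  fixes \<mu> :: "nat \<Rightarrow> (real^'d) measure"
  assumes \<mu>: "\<And>n. prob_space (\<mu> n)" "\<And>n. sets (\<mu> n) = sets borel"
    and \<nu>: "prob_space \<nu>" "sets \<nu> = sets borel"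
    and conv: "\<And>t. (\<lambda>n. CLINT x|\<mu> n. cis (t \<bullet> x)) \<longlonglongrightarrow> (CLINT x|\<nu>. cis (t \<bullet> x))"
  shows "weak_conv_vec \<mu> \<nu>"
proof -
  note [measurable_cong] = \<mu>(2) \<nu>(2)
  have space: "space (\<mu> n) = UNIV" "space \<nu> = UNIV" for n
    using \<mu>(2)[THEN sets_eq_imp_space_eq] \<nu>(2)[THEN sets_eq_imp_space_eq] by auto
  have meas_norm: "{x::real^'d. K < norm x} \<in> sets borel" for K by measurable
  \<comment> \<open>The vectors \<open>axis i s\<close> turn the hypothesis into convergence of the
    characteristic functions of the \<open>i\<close>-th marginals.\<close>
  have tight_coord: "\<exists>K. \<forall>\<^sub>F n in sequentially. measure (\<mu> n) {x. K < \<bar>x $ i\<bar>} < e" if "e > 0" for i e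
  proof -
    have rd: "real_distribution (distr M borel (\<lambda>x. x $ i))"
      if "prob_space M" "sets M = sets (borel :: (real^'d) measure)" for M
      using that by (intro prob_space.real_distribution_distr) (auto cong: measurable_cong_sets)
    have ch: "char (distr M borel (\<lambda>x. x $ i)) s = (CLINT x|M. cis (axis i s \<bullet> x))"
      if "sets M = sets (borel :: (real^'d) measure)" for M s
    proof -
      have [measurable_cong]: "sets M = sets borel" by fact
      have "char (distr M borel (\<lambda>x. x $ i)) s = (CLINT x|M. iexp (s * x $ i))"
        unfolding char_def by (intro integral_distr) measurable
      then show ?thesis by (simp add: cis_conv_exp inner_axis' )
    qed
    have w: "weak_conv_m (\<lambda>n. distr (\<mu> n) borel (\<lambda>x. x $ i)) (distr \<nu> borel (\<lambda>x. x $ i))"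
      using conv by (intro levy_continuity rd \<mu> \<nu>) (simp add: ch \<mu> \<nu>)
    have "\<exists>K. \<forall>\<^sub>F n in sequentially. measure (distr (\<mu> n) borel (\<lambda>x. x $ i)) {x. K < norm x} < e"
    proof (rule weak_limit_tight[OF _ _ _ _ _ that])
      fix f :: "real \<Rightarrow> real" assume f: "continuous_on UNIV f" "bounded (range f)"
      then obtain B where "\<And>x. norm (f x) \<le> B" by (auto simp: bounded_iff)
      then show "(\<lambda>n. \<integral>x. f x \<partial>distr (\<mu> n) borel (\<lambda>x. x $ i)) \<longlonglongrightarrow> (\<integral>x. f x \<partial>distr \<nu> borel (\<lambda>x. x $ i))"
        using f(1) by (intro weak_conv_imp_integral_bdd_continuous_conv[OF rd rd w] \<mu> \<nu>)
          (auto simp: continuous_on_eq_continuous_at)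
    qed (use rd[OF \<mu>] rd[OF \<nu>] in \<open>auto simp: real_distribution_def\<close>)
    moreover have "measure (distr (\<mu> n) borel (\<lambda>x. x $ i)) {x. K < norm x} = measure (\<mu> n) {x. K < \<bar>x $ i\<bar>}" for n K
      by (subst measure_distr) (auto simp: space vimage_def)
    ultimately show ?thesis by simp
  qed
  have tight: "\<exists>K. \<forall>\<^sub>F n in sequentially. measure (\<mu> n) {x. K < norm x} < e" if "e > 0" for e
  proof -
    define d where "d = real CARD('d)"
    have d: "d > 0" by (simp add: d_def)
    have "\<forall>i. \<exists>k. \<forall>\<^sub>F n in sequentially. measure (\<mu> n) {x. k < \<bar>x $ i\<bar>} < e / d"
      using tight_coord[of "e / d"] that d by simp
    from choice[OF this] obtain k
      where k: "\<forall>i. \<forall>\<^sub>F n in sequentially. measure (\<mu> n) {x. k i < \<bar>x $ i\<bar>} < e / d"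
      by (elim exE)
    \<comment> \<open>The norm is at most the sum of the absolute coordinates, so a norm beyond
      \<open>K\<close> forces some coordinate beyond its own bound.\<close>
    define K where "K = (\<Sum>i\<in>UNIV. \<bar>k i\<bar>)"
    have "\<forall>\<^sub>F n in sequentially. \<forall>i. measure (\<mu> n) {x. k i < \<bar>x $ i\<bar>} < e / d"
      using k by (simp add: eventually_all_finite)
    then have "\<forall>\<^sub>F n in sequentially. measure (\<mu> n) {x. K < norm x} < e"
    proof eventually_elim
      case (elim n)
      interpret M: prob_space "\<mu> n" by (rule \<mu>)
      have "{x. K < norm x} \<subseteq> (\<Union>i\<in>UNIV. {x. k i < \<bar>x $ i\<bar>})"
      proof
        fix x :: "real^'d" assume "x \<in> {x. K < norm x}"
        then have "K < (\<Sum>i\<in>UNIV. \<bar>x $ i\<bar>)" using norm_le_l1_cart[of x] by simp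
        then obtain i where "\<bar>k i\<bar> < \<bar>x $ i\<bar>" unfolding K_def by (metis sum_mono not_le)
        then have "k i < \<bar>x $ i\<bar>" by linarith
        then show "x \<in> (\<Union>i\<in>UNIV. {x. k i < \<bar>x $ i\<bar>})" by blast
      qed
      then have "measure (\<mu> n) {x. K < norm x} \<le> measure (\<mu> n) (\<Union>i\<in>UNIV. {x. k i < \<bar>x $ i\<bar>})"
        by (intro M.finite_measure_mono) auto
      also have "\<dots> \<le> (\<Sum>i\<in>UNIV. measure (\<mu> n) {x. k i < \<bar>x $ i\<bar>})"
        by (intro M.finite_measure_subadditive_finite) auto
      also have "\<dots> < (\<Sum>i\<in>(UNIV::'d set). e / d)"
        using elim by (intro sum_strict_mono) auto
      also have "\<dots> = e" using d by (simp add: d_def)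
      finally show ?case .
    qed
    then show ?thesis by blast
  qed
  have trig: "(\<lambda>n. \<integral>x. g x \<partial>\<mu> n) \<longlonglongrightarrow> (\<integral>x. g x \<partial>\<nu>)" if "trig_polynomial g" for g :: "real^'d \<Rightarrow> real"
    using that
  proof induction
    case (cos t)
    show ?case
      using tendsto_Re[OF conv[of t]] by (simp flip: integral_Re add: integrable_cis_inner \<mu> \<nu>)
  next
    case (sin t)
    show ?case
      using tendsto_Im[OF conv[of t]] by (simp flip: integral_Im add: integrable_cis_inner \<mu> \<nu>)
  next
    case (scale f c)
    then show ?case by (simp add: tendsto_mult_left)
  next
    case (add f g)
    have "integrable M h" if "prob_space M" "sets M = sets borel" and h: "trig_polynomial h" for M and h :: "real^'d \<Rightarrow> real"
    proof -
      interpret prob_space M by fact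
      have [measurable_cong]: "sets M = sets borel" by fact
      have "h \<in> borel_measurable borel"
        by (rule borel_measurable_continuous_onI[OF trig_polynomial_continuous[OF h]])
      then have [measurable]: "h \<in> borel_measurable M" by simp
      obtain B where "\<forall>x. \<bar>h x\<bar> \<le> B" using trig_polynomial_bounded[OF h] by blast
      then show ?thesis by (intro integrable_const_bound[where B = B]) auto
    qed
    then show ?case using add by (simp add: \<mu> \<nu> tendsto_add)
  qed
  show ?thesis
    unfolding weak_conv_vec_def
  proof (intro allI impI, elim conjE)
    fix f :: "real^'d \<Rightarrow> real" assume f: "continuous_on UNIV f" "bounded (range f)"
    then obtain B where B: "\<And>x. \<bar>f x\<bar> \<le> B" by (auto simp: bounded_iff)
    then have B0: "0 \<le> B" using abs_ge_zero order_trans by blast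
    have fm: "f \<in> borel_measurable borel" by (rule borel_measurable_continuous_onI[OF f(1)])
    show "(\<lambda>n. \<integral>x. f x \<partial>\<mu> n) \<longlonglongrightarrow> (\<integral>x. f x \<partial>\<nu>)"
    proof (rule LIMSEQ_I)
      fix r :: real assume "r > 0"
      \<comment> \<open>Two approximation errors of at most \<open>e + (2 * B + 1) * e\<close> and
        one convergence error \<open>e\<close> add up to \<open>(4 * B + 5) * e\<close>, below
        \<open>r\<close>. The cap at 1 absorbs the term \<open>e\<close> in the bound
        \<open>B + e\<close> for \<open>g\<close>.\<close>
      define e where "e = min 1 (r / (4 * B + 10))"
      have e: "e > 0" "e \<le> 1" "(4 * B + 10) * e \<le> r"
        using \<open>r > 0\<close> B0 mult_left_mono[of e "r / (4 * B + 10)" "4 * B + 10"] by (auto simp: e_def)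
      obtain K1 where K1: "\<forall>\<^sub>F n in sequentially. measure (\<mu> n) {x. K1 < norm x} < e"
        using tight[OF e(1)] by blast
      have "(\<lambda>k::nat. measure \<nu> {x. real k < norm x}) \<longlonglongrightarrow> 0"
        using \<nu> by (intro measure_norm_tail_tendsto_0) (auto intro: prob_space.finite_measure)
      then obtain K2 :: nat where K2: "measure \<nu> {x. real K2 < norm x} < e"
        using order_tendstoD(2)[OF _ e(1)] by (metis (no_types, lifting) eventually_sequentially order_refl)
      define K where "K = max K1 (real K2)"
      obtain g where g: "trig_polynomial g" "\<And>x. \<bar>g x\<bar> \<le> B + e" "\<And>x. x \<in> cball 0 K \<Longrightarrow> \<bar>f x - g x\<bar> < e"
        using trig_polynomial_approx[OF continuous_on_subset[OF f(1) subset_UNIV] e(1) B, of K] by blast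
      have gm: "g \<in> borel_measurable borel"
        by (rule borel_measurable_continuous_onI[OF trig_polynomial_continuous[OF g(1)]])
      have approx: "\<bar>(\<integral>x. f x \<partial>M) - (\<integral>x. g x \<partial>M)\<bar> \<le> e + (2 * B + 1) * e"
        if M: "prob_space M" "sets M = sets borel" "measure M {x. k < norm x} < e" and "k \<le> K" for M k
      proof -
        interpret M: prob_space M by fact
        have "\<bar>(\<integral>x. f x \<partial>M) - (\<integral>x. g x \<partial>M)\<bar> \<le> e + (B + (B + e)) * measure M {x. k < norm x}"
        proof (rule integral_diff_le[OF M(1) _ _ _ B g(2)])
          fix x assume "x \<in> space M - {x. k < norm x}"
          then show "\<bar>f x - g x\<bar> \<le> e" using \<open>k \<le> K\<close> by (intro less_imp_le g(3)) auto
        qed (use fm gm meas_norm e(1) in \<open>auto simp: M(2) cong: measurable_cong_sets\<close>)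
        also have "(B + (B + e)) * measure M {x. k < norm x} \<le> (2 * B + 1) * e"
          using B0 e M(3) by (intro mult_mono) auto
        finally show ?thesis by simp
      qed
      have "\<forall>\<^sub>F n in sequentially. \<bar>(\<integral>x. g x \<partial>\<mu> n) - (\<integral>x. g x \<partial>\<nu>)\<bar> < e"
        using tendstoD[OF trig[OF g(1)] e(1)] by (simp add: dist_real_def)
      with K1 have "\<forall>\<^sub>F n in sequentially. norm ((\<integral>x. f x \<partial>\<mu> n) - (\<integral>x. f x \<partial>\<nu>)) < r"
      proof eventually_elim
        case (elim n)
        have 1: "\<bar>(\<integral>x. f x \<partial>\<mu> n) - (\<integral>x. g x \<partial>\<mu> n)\<bar> \<le> e + (2 * B + 1) * e"
          by (rule approx[OF \<mu> elim(1)]) (simp add: K_def)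
        have 2: "\<bar>(\<integral>x. f x \<partial>\<nu>) - (\<integral>x. g x \<partial>\<nu>)\<bar> \<le> e + (2 * B + 1) * e"
          by (rule approx[OF \<nu> K2]) (simp add: K_def)
        have "e + (2 * B + 1) * e + (e + (2 * B + 1) * e) + e < (4 * B + 10) * e"
          using e by (simp add: algebra_simps)
        then show ?case using 1 2 elim(2) e(3) unfolding real_norm_def by linarith
      qed
      then show "\<exists>N. \<forall>n\<ge>N. norm ((\<integral>x. f x \<partial>\<mu> n) - (\<integral>x. f x \<partial>\<nu>)) < r"
        by (simp add: eventually_sequentially)
    qed
  qed
qed

text \<open>Tightness confines the mass to a ball, where \<open>h n\<close> is nearly the identity
  and a test function is uniformly continuous. Used once with logarithms (a delta method) and once
  with exponentials.\<close>

lemma weak_conv_vec_perturb: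
  fixes \<mu> :: "nat \<Rightarrow> (real^'d) measure"
  assumes \<mu>: "\<And>n. prob_space (\<mu> n)" "\<And>n. sets (\<mu> n) = sets borel"
    and \<nu>: "prob_space \<nu>" "sets \<nu> = sets borel"
    and w: "weak_conv_vec \<mu> \<nu>"
    and h[measurable]: "\<And>n. h n \<in> borel_measurable borel"
    and unif: "\<And>K e. e > 0 \<Longrightarrow> \<forall>\<^sub>F n in sequentially. \<forall>x. norm x \<le> K \<longrightarrow> norm (h n x - x) < e"
  shows "weak_conv_vec (\<lambda>n. distr (\<mu> n) borel (h n)) \<nu>"
  unfolding weak_conv_vec_def
proof (intro allI impI, elim conjE)
  note [measurable_cong] = \<mu>(2) \<nu>(2)
  fix f :: "real^'d \<Rightarrow> real" assume f: "continuous_on UNIV f" "bounded (range f)"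
  then obtain B where B: "\<And>x. \<bar>f x\<bar> \<le> B" by (auto simp: bounded_iff)
  then have B0: "0 \<le> B" using abs_ge_zero order_trans by blast
  have [measurable]: "f \<in> borel_measurable borel" by (rule borel_measurable_continuous_onI[OF f(1)])
  have "(\<lambda>n. (\<integral>x. f (h n x) \<partial>\<mu> n) - (\<integral>x. f x \<partial>\<mu> n)) \<longlonglongrightarrow> 0"
  proof (rule LIMSEQ_I)
    fix r :: real assume "r > 0"
    define e where "e = r / (2 * B + 2)"
    have e: "e > 0" "e + (B + B) * e < r"
      using \<open>r > 0\<close> B0 by (auto simp: e_def field_simps add_pos_nonneg)
    obtain K where K: "\<forall>\<^sub>F n in sequentially. measure (\<mu> n) {x. K < norm x} < e"
      using weak_limit_tight[OF \<mu> \<nu> w[unfolded weak_conv_vec_def, rule_format, OF conjI] e(1)] by blast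
    \<comment> \<open>The radius \<open>K + 1\<close> makes room for \<open>h n x\<close> as well,
      which is eventually at distance less than 1 from \<open>x\<close>.\<close>
    have "uniformly_continuous_on (cball 0 (K + 1)) f"
      by (intro compact_uniformly_continuous continuous_on_subset[OF f(1)]) auto
    then obtain d where d: "d > 0"
      "\<And>x y. x \<in> cball 0 (K + 1) \<Longrightarrow> y \<in> cball 0 (K + 1) \<Longrightarrow> dist y x < d \<Longrightarrow> dist (f y) (f x) < e"
      unfolding uniformly_continuous_on_def using e(1) by metis
    have "\<forall>\<^sub>F n in sequentially. \<forall>x. norm x \<le> K \<longrightarrow> norm (h n x - x) < min d 1"
      using d(1) by (intro unif) auto
    with K have "\<forall>\<^sub>F n in sequentially. norm ((\<integral>x. f (h n x) \<partial>\<mu> n) - (\<integral>x. f x \<partial>\<mu> n) - 0) < r"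
    proof eventually_elim
      case (elim n)
      have "\<bar>(\<integral>x. f (h n x) \<partial>\<mu> n) - (\<integral>x. f x \<partial>\<mu> n)\<bar> \<le> e + (B + B) * measure (\<mu> n) {x. K < norm x}"
      proof (rule integral_diff_le[OF \<mu>(1) _ _ _ B B])
        fix x assume "x \<in> space (\<mu> n) - {x. K < norm x}"
        then have x: "norm x \<le> K" by auto
        then have hx: "norm (h n x - x) < min d 1" using elim by blast
        then have "norm (h n x) \<le> K + 1" using x norm_triangle_sub[of "h n x" x] by simp
        then show "\<bar>f (h n x) - f x\<bar> \<le> e"
          using d(2)[of x "h n x"] x hx by (simp add: dist_norm)
      qed (use e(1) in \<open>simp_all, measurable\<close>)
      also have "(B + B) * measure (\<mu> n) {x. K < norm x} \<le> (B + B) * e"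
        using elim B0 by (intro mult_left_mono) auto
      finally show ?case using e(2) by simp
    qed
    then show "\<exists>N. \<forall>n\<ge>N. norm ((\<integral>x. f (h n x) \<partial>\<mu> n) - (\<integral>x. f x \<partial>\<mu> n) - 0) < r"
      by (simp add: eventually_sequentially)
  qed
  moreover have "(\<lambda>n. \<integral>x. f x \<partial>\<mu> n) \<longlonglongrightarrow> (\<integral>x. f x \<partial>\<nu>)"
    using w f by (simp add: weak_conv_vec_def)
  ultimately have "(\<lambda>n. \<integral>x. f (h n x) \<partial>\<mu> n) \<longlonglongrightarrow> (\<integral>x. f x \<partial>\<nu>)"
    using tendsto_add by fastforce
  then show "(\<lambda>n. \<integral>x. f x \<partial>distr (\<mu> n) borel (h n)) \<longlonglongrightarrow> (\<integral>x. f x \<partial>\<nu>)"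
    by (simp add: integral_distr)
qed

text \<open>The easy converse of \<open>levy_continuity_vec\<close>: it returns from measures, where
  perturbations are carried out, to characteristic functions, where the radial factor can be divided
  out.\<close>

lemma weak_conv_vec_cis:
  fixes \<mu> :: "nat \<Rightarrow> (real^'d) measure"
  assumes \<mu>: "\<And>n. prob_space (\<mu> n)" "\<And>n. sets (\<mu> n) = sets borel"
    and \<nu>: "prob_space \<nu>" "sets \<nu> = sets borel"
    and w: "weak_conv_vec \<mu> \<nu>"
  shows "(\<lambda>n. CLINT x|\<mu> n. cis (t \<bullet> x)) \<longlonglongrightarrow> (CLINT x|\<nu>. cis (t \<bullet> x))"
proof -
  have "(\<lambda>n. \<integral>x. cos (t \<bullet> x) \<partial>\<mu> n) \<longlonglongrightarrow> (\<integral>x. cos (t \<bullet> x) \<partial>\<nu>)"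
    "(\<lambda>n. \<integral>x. sin (t \<bullet> x) \<partial>\<mu> n) \<longlonglongrightarrow> (\<integral>x. sin (t \<bullet> x) \<partial>\<nu>)"
    by (intro w[unfolded weak_conv_vec_def, rule_format] conjI continuous_intros;
        auto simp: bounded_iff intro!: exI[of _ 1])+
  then show ?thesis
    by (simp add: tendsto_complex_iff integrable_cis_inner \<mu> \<nu> flip: integral_Re integral_Im)
qed

subsection \<open>Central limit theorem for logarithms of norms\<close>

text \<open>The central limit theorem for one direction, without standardising: nothing is divided
  by the standard deviation, so the variance may be 0, as can happen for a linear combination of
  coordinates.\<close>

lemma char_power_tendsto_gaussian:
  assumes "prob_space G" and [measurable]: "w \<in> borel_measurable G"
    and w: "integrable G w" "integrable G (\<lambda>x. (w x)\<^sup>2)" "(\<integral>x. w x \<partial>G) = 0"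
  shows "(\<lambda>n. (CLINT x|G. cis (w x / sqrt (real n))) ^ n) \<longlonglongrightarrow>
    complex_of_real (exp (- (\<integral>x. (w x)\<^sup>2 \<partial>G) / 2))"
proof -
  interpret G: prob_space G by fact
  define \<mu> where "\<mu> = distr G borel w"
  interpret \<mu>: real_distribution \<mu> unfolding \<mu>_def by (rule G.real_distribution_distr) measurable
  define v where "v = (\<integral>x. (w x)\<^sup>2 \<partial>G)"
  have v0: "v \<ge> 0" by (simp add: v_def)
  have \<mu>: "integrable \<mu> (\<lambda>x. x)" "\<mu>.expectation (\<lambda>x. x) = 0" "integrable \<mu> (\<lambda>x. x^2)"
    "\<mu>.expectation (\<lambda>x. x^2) = v"
    using w by (simp_all add: \<mu>_def integrable_distr_eq integral_distr v_def)
  define \<psi> where "\<psi> n = char \<mu> (1 / sqrt (real n))" for n :: nat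
  have \<psi>: "(CLINT x|G. cis (w x / sqrt (real n))) = \<psi> n" for n
    by (simp add: \<psi>_def char_def \<mu>_def integral_distr cis_conv_exp)
  have main: "\<forall>\<^sub>F n in sequentially. norm (\<psi> n ^ n - complex_of_real ((1 + (- v / 2) / n) ^ n)) \<le>
      (LINT x|\<mu>. min (6 * x\<^sup>2) (\<bar>1 / sqrt n\<bar> * \<bar>x\<bar> ^ 3)) / 6"
  proof (rule eventually_sequentiallyI)
    \<comment> \<open>\<open>n \<ge> v / 4\<close> is what gives
      \<open>\<bar>1 - v / (2 * n)\<bar> \<le> 1\<close>, so that the difference of
      \<open>n\<close>-th powers is at most \<open>n\<close> times the difference of the
      bases.\<close>
    fix n :: nat assume "n \<ge> nat \<lceil>v / 4\<rceil> + 1"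
    then have n: "real n \<ge> v / 4" "n > 0" by (linarith | simp add: nat_ceiling_le_eq)+
    have "norm (\<psi> n - (1 - (1 / sqrt n)^2 * v / 2))
        \<le> (1 / sqrt n)\<^sup>2 / 6 * (LINT x|\<mu>. min (6 * x\<^sup>2) (\<bar>1 / sqrt n\<bar> * \<bar>x\<bar> ^ 3))"
      unfolding \<psi>_def using \<mu> by (intro \<mu>.char_approx3) auto
    then have *: "norm (\<psi> n - complex_of_real (1 + (- v / 2) / n))
        \<le> (LINT x|\<mu>. min (6 * x\<^sup>2) (\<bar>1 / sqrt n\<bar> * \<bar>x\<bar> ^ 3)) / 6 / n"
      by (simp add: power_divide mult.commute)
    have "norm (\<psi> n ^ n - complex_of_real (1 + (- v / 2) / n) ^ n)
        \<le> n * norm (\<psi> n - complex_of_real (1 + (- v / 2) / n))"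
    proof (rule norm_power_diff)
      show "norm (complex_of_real (1 + (- v / 2) / n)) \<le> 1"
        unfolding norm_of_real using n v0 by (intro abs_leI) (auto simp: field_simps)
    qed (simp add: \<psi>_def \<mu>.cmod_char_le_1)
    also have "\<dots> \<le> n * ((LINT x|\<mu>. min (6 * x\<^sup>2) (\<bar>1 / sqrt n\<bar> * \<bar>x\<bar> ^ 3)) / 6 / n)"
      by (rule mult_left_mono[OF *]) simp
    also have "\<dots> = (LINT x|\<mu>. min (6 * x\<^sup>2) (\<bar>1 / sqrt n\<bar> * \<bar>x\<bar> ^ 3)) / 6"
      using n by simp
    finally show "norm (\<psi> n ^ n - complex_of_real ((1 + (- v / 2) / n) ^ n)) \<le>
      (LINT x|\<mu>. min (6 * x\<^sup>2) (\<bar>1 / sqrt n\<bar> * \<bar>x\<bar> ^ 3)) / 6" by simp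
  qed
  \<comment> \<open>The Taylor error is truncated at \<open>6 * x^2\<close>, an integrable bound, so
    dominated convergence works without a third moment.\<close>
  have "(\<lambda>n::nat. min (6 * x\<^sup>2) (\<bar>1 / sqrt n\<bar> * \<bar>x\<bar> ^ 3)) \<longlonglongrightarrow> min (6 * x\<^sup>2) (\<bar>0\<bar> * \<bar>x\<bar> ^ 3)" for x :: real
    by (intro tendsto_intros tendsto_divide_0[OF tendsto_const] filterlim_at_top_imp_at_infinity
        sqrt_at_top[THEN filterlim_compose] filterlim_real_sequentially)
  then have "(\<lambda>n::nat. LINT x|\<mu>. min (6 * x\<^sup>2) (\<bar>1 / sqrt n\<bar> * \<bar>x\<bar> ^ 3)) \<longlonglongrightarrow> (LINT x|\<mu>. 0)"
    using \<mu>(3) by (intro integral_dominated_convergence[where w = "\<lambda>x. 6 * x^2"]) (auto simp: min_absorb2)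
  then have *: "(\<lambda>n::nat. (LINT x|\<mu>. min (6 * x\<^sup>2) (\<bar>1 / sqrt n\<bar> * \<bar>x\<bar> ^ 3)) / 6) \<longlonglongrightarrow> 0"
    by (simp only: integral_zero tendsto_divide_zero)
  have "(\<lambda>n::nat. complex_of_real ((1 + (- v / 2) / n)^n)) \<longlonglongrightarrow> complex_of_real (exp (- v / 2))"
    by (rule isCont_tendsto_compose[OF _ tendsto_exp_limit_sequentially]) auto
  then have "(\<lambda>n. \<psi> n ^ n) \<longlonglongrightarrow> complex_of_real (exp (- v / 2))"
    by (rule Lim_transform) (rule Lim_null_comparison[OF main *])
  then show ?thesis by (simp add: \<psi> v_def)
qed

text \<open>\<open>a\<close> compensates for the size of the vectors: it is \<open>1 / p\<close> for
  points of the ball (0 for the cube) and 0 for i.i.d. coordinates. \<open>m i\<close> stands for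
  the moment of order \<open>q i\<close>.\<close>

definition log_norms :: "real \<Rightarrow> ('d::finite \<Rightarrow> real) \<Rightarrow> ('d \<Rightarrow> real) \<Rightarrow> nat \<Rightarrow> (nat \<Rightarrow> real) \<Rightarrow> real^'d" where
  "log_norms a m q n x = (\<chi> i. sqrt (real n) *
     ln (real n powr (a - 1 / q i) * lp_norm n (ereal (q i)) x / m i powr (1 / q i)))"

lemma lp_norm_finite: "lp_norm n (ereal r) x = (\<Sum>i<n. \<bar>x i\<bar> powr r) powr (1 / r)"
  by (simp add: lp_norm_def)

lemma borel_measurable_lp_norm[measurable]:
  assumes "sets M = sets (borel :: real measure)"
  shows "lp_norm n p \<in> borel_measurable (PiM {..<n} (\<lambda>_. M))"
proof -
  have [measurable]: "(\<lambda>x. x i) \<in> borel_measurable (PiM {..<n} (\<lambda>_. M))" if "i \<in> {..<n}" for i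
    using measurable_component_singleton[OF that, of "\<lambda>_. M"] assms by (simp cong: measurable_cong_sets)
  show ?thesis
  proof (cases "p = \<infinity>")
    case True
    \<comment> \<open>The extra index \<open>n\<close> supplies the inserted 0, so the maximum runs
      over a fixed nonempty index set.\<close>
    have "lp_norm n p = (\<lambda>x. Max ((\<lambda>i. if i < n then \<bar>x i\<bar> else 0) ` {..n}))"
    proof
      fix x :: "nat \<Rightarrow> real"
      have "insert 0 ((\<lambda>i. \<bar>x i\<bar>) ` {..<n}) = (\<lambda>i. if i < n then \<bar>x i\<bar> else 0) ` {..n}"
        by (auto simp: image_iff le_less)
      then show "lp_norm n p x = Max ((\<lambda>i. if i < n then \<bar>x i\<bar> else 0) ` {..n})"
        using True by (simp add: lp_norm_def)
    qed
    moreover have "(\<lambda>x. if i < n then \<bar>x i\<bar> else 0) \<in> borel_measurable (PiM {..<n} (\<lambda>_. M))" for i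
      by (cases "i < n") auto
    then have "(\<lambda>x. Max ((\<lambda>i. if i < n then \<bar>x i\<bar> else 0) ` {..n})) \<in> borel_measurable (PiM {..<n} (\<lambda>_. M))"
      by (intro borel_measurable_Max) auto
    ultimately show ?thesis by simp
  next
    case False
    then have "lp_norm n p = (\<lambda>x. (\<Sum>i<n. \<bar>x i\<bar> powr real_of_ereal p) powr (1 / real_of_ereal p))"
      by (simp add: lp_norm_def fun_eq_iff)
    then show ?thesis by simp
  qed
qed

lemma borel_measurable_vec_lambda[measurable (raw)]:
  fixes f :: "'a \<Rightarrow> 'd::finite \<Rightarrow> real"
  assumes "\<And>i. (\<lambda>x. f x i) \<in> borel_measurable M"
  shows "(\<lambda>x. \<chi> i. f x i) \<in> borel_measurable M"
proof -
  have "(\<lambda>x. \<chi> i. f x i) = (\<lambda>x. \<Sum>i\<in>UNIV. f x i *\<^sub>R axis i 1)"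
    by (simp add: fun_eq_iff vec_eq_iff sum_component axis_def if_distrib cong: if_cong)
  then show ?thesis using assms by simp
qed

lemma borel_measurable_log_norms[measurable]:
  assumes "sets M = sets (borel :: real measure)"
  shows "log_norms a m q n \<in> borel_measurable (PiM {..<n} (\<lambda>_. M))"
  unfolding log_norms_def[abs_def] using borel_measurable_lp_norm[OF assms] by measurable

section \<open>Maps that converge to the identity uniformly on bounded sets\<close>

lemma uniformly_id_vec:
  fixes g :: "nat \<Rightarrow> 'd::finite \<Rightarrow> real \<Rightarrow> real"
  assumes g: "\<And>i K e. e > 0 \<Longrightarrow> \<forall>\<^sub>F n in sequentially. \<forall>x. \<bar>x\<bar> \<le> K \<longrightarrow> \<bar>g n i x - x\<bar> < e"
    and "e > 0"
  shows "\<forall>\<^sub>F n in sequentially. \<forall>x. norm x \<le> K \<longrightarrow> norm ((\<chi> i. g n i (x $ i)) - x) < e"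
proof -
  define d where "d = e / real CARD('d)"
  have "d > 0" using \<open>e > 0\<close> by (simp add: d_def)
  then have "\<forall>\<^sub>F n in sequentially. \<forall>i. \<forall>x. \<bar>x\<bar> \<le> K \<longrightarrow> \<bar>g n i x - x\<bar> < d"
    by (simp add: eventually_all_finite g)
  then show ?thesis
  proof eventually_elim
    case (elim n)
    show ?case
    proof (intro allI impI)
      fix x :: "real^'d" assume x: "norm x \<le> K"
      have "norm ((\<chi> i. g n i (x $ i)) - x) \<le> (\<Sum>i\<in>UNIV. \<bar>((\<chi> i. g n i (x $ i)) - x) $ i\<bar>)"
        by (rule norm_le_l1_cart)
      also have "\<dots> < (\<Sum>i\<in>(UNIV::'d set). d)"
        using elim x component_le_norm_cart[of x] by (intro sum_strict_mono) (auto intro: order_trans)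
      finally show "norm ((\<chi> i. g n i (x $ i)) - x) < e" by (simp add: d_def)
    qed
  qed
qed

lemma eventually_div_sqrt_less:
  "e > 0 \<Longrightarrow> \<forall>\<^sub>F n in sequentially. c / sqrt (real n) < e"
  by (rule order_tendstoD[of _ 0])
     (intro tendsto_divide_0[OF tendsto_const] filterlim_at_top_imp_at_infinity
        sqrt_at_top[THEN filterlim_compose] filterlim_real_sequentially)

text \<open>With \<open>y = q * x / sqrt n\<close>, the bound
  \<open>\<bar>ln (1 + y) - y\<bar> \<le> 2 * y^2\<close> leaves an error of at most
  \<open>2 * q * K^2 / sqrt n\<close>.\<close>

lemma uniformly_id_ln:
  assumes "q > 0" "e > 0"
  shows "\<forall>\<^sub>F n in sequentially. \<forall>x. \<bar>x\<bar> \<le> K \<longrightarrow> \<bar>sqrt (real n) / q * ln (1 + q * x / sqrt (real n)) - x\<bar> < e"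
  using eventually_div_sqrt_less[OF half_gt_zero[OF zero_less_one], of "q * K"] eventually_div_sqrt_less[OF assms(2), of "2 * q * K\<^sup>2"]
    eventually_gt_at_top[of 0]
proof eventually_elim
  case (elim n)
  show ?case
  proof (intro allI impI)
    fix x assume x: "\<bar>x\<bar> \<le> K"
    define s where "s = sqrt (real n)"
    have s: "s > 0" using elim by (simp add: s_def)
    define y where "y = q * x / s"
    have "\<bar>y\<bar> \<le> q * K / s" using x s assms by (simp add: y_def abs_mult divide_right_mono)
    then have "\<bar>y\<bar> \<le> 1 / 2" using elim(1) unfolding s_def by linarith
    then have "\<bar>ln (1 + y) - y\<bar> \<le> 2 * y\<^sup>2" by (rule abs_ln_one_plus_x_minus_x_bound)
    have "s / q * ln (1 + y) - x = s / q * (ln (1 + y) - y)"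
      using s assms by (simp add: y_def field_simps)
    also have "\<bar>\<dots>\<bar> \<le> s / q * (2 * y\<^sup>2)"
      using s assms \<open>\<bar>ln (1 + y) - y\<bar> \<le> 2 * y\<^sup>2\<close> unfolding abs_mult by (intro mult_mono) auto
    also have "\<dots> = 2 * q * x\<^sup>2 / s"
      using s assms by (simp add: y_def power2_eq_square field_simps)
    also have "\<dots> \<le> 2 * q * K\<^sup>2 / s"
      using s assms power_mono[OF x, of 2] by (intro divide_right_mono mult_left_mono) auto
    also have "\<dots> < e" using elim by (simp add: s_def)
    finally show "\<bar>sqrt (real n) / q * ln (1 + q * x / sqrt (real n)) - x\<bar> < e"
      by (simp add: s_def y_def)
  qed
qed

lemma abs_exp_minus_one_minus_le:
  fixes y :: real
  assumes "\<bar>y\<bar> \<le> 1"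
  shows "\<bar>exp y - 1 - y\<bar> \<le> y\<^sup>2"
proof (cases "y \<ge> 0")
  case True
  then have "exp y \<le> 1 + y + y\<^sup>2" using assms by (intro exp_bound) auto
  then show ?thesis using exp_ge_add_one_self[of y] zero_le_power2[of y] by linarith
next
  case False
  then have "exp y * (1 - y) \<le> 1"
    using exp_ge_add_one_self[of "- y"] mult_left_mono[of "1 - y" "exp (- y)" "exp y"]
    by (simp flip: exp_add)
  then have "exp y \<le> 1 / (1 - y)" using False by (simp add: field_simps)
  \<comment> \<open>\<open>(1 - y) * (1 + y + y^2) = 1 - y^3\<close>, which is at least 1 for
    negative \<open>y\<close>.\<close>
  also have "\<dots> \<le> 1 + y + y\<^sup>2"
    using False by (simp add: divide_le_eq power2_eq_square algebra_simps mult_nonpos_nonneg mult_nonneg_nonpos)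
  finally show ?thesis using exp_ge_add_one_self[of y] by linarith
qed

lemma uniformly_id_exp:
  assumes "e > 0"
  shows "\<forall>\<^sub>F n in sequentially. \<forall>x. \<bar>x\<bar> \<le> K \<longrightarrow> \<bar>sqrt (real n) * (exp (x / sqrt (real n)) - 1) - x\<bar> < e"
  using eventually_div_sqrt_less[OF zero_less_one, of K] eventually_div_sqrt_less[OF assms, of "K\<^sup>2"]
    eventually_gt_at_top[of 0]
proof eventually_elim
  case (elim n)
  show ?case
  proof (intro allI impI)
    fix x assume x: "\<bar>x\<bar> \<le> K"
    define s where "s = sqrt (real n)"
    have s: "s > 0" using elim by (simp add: s_def)
    define y where "y = x / s"
    have "\<bar>y\<bar> \<le> K / s" using x s by (simp add: y_def divide_right_mono)
    then have "\<bar>y\<bar> \<le> 1" using elim(1) unfolding s_def by linarith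
    then have *: "\<bar>exp y - 1 - y\<bar> \<le> y\<^sup>2" by (rule abs_exp_minus_one_minus_le)
    have "s * (exp y - 1) - x = s * (exp y - 1 - y)"
      using s by (simp add: y_def field_simps)
    also have "\<bar>\<dots>\<bar> \<le> s * y\<^sup>2" using s * unfolding abs_mult by (intro mult_mono) auto
    also have "\<dots> = x\<^sup>2 / s" using s by (simp add: y_def power2_eq_square)
    also have "\<dots> \<le> K\<^sup>2 / s" using s power_mono[OF x, of 2] by (intro divide_right_mono) auto
    also have "\<dots> < e" using elim by (simp add: s_def)
    finally show "\<bar>sqrt (real n) * (exp (x / sqrt (real n)) - 1) - x\<bar> < e"
      by (simp add: s_def y_def)
  qed
qed

text \<open>\<open>G\<close> and its moment function \<open>M\<close> are left abstract so that the
  p-Gaussian law and the uniform law on \<open>[-1, 1]\<close> are both covered. The limit is proved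
  for normalised sums of linearised powers and then carried over to the logarithms.\<close>

lemma log_norms_clt:
  fixes q :: "'d::finite \<Rightarrow> real"
  assumes G: "prob_space G" "sets G = sets borel"
    and q: "\<And>i. q i > 0"
    and int: "\<And>r. r \<ge> 0 \<Longrightarrow> integrable G (\<lambda>x. \<bar>x\<bar> powr r)"
    and M: "\<And>r. r > 0 \<Longrightarrow> (\<integral>x. \<bar>x\<bar> powr r \<partial>G) = M r" and pos: "\<And>r. r > 0 \<Longrightarrow> M r > 0"
    and C: "\<And>i j. C $ i $ j = (M (q i + q j) - M (q i) * M (q j)) / (q i * q j * M (q i) * M (q j))"
  shows "(\<lambda>n. CLINT x|PiM {..<n} (\<lambda>_. G). cis (t \<bullet> log_norms 0 (\<lambda>i. M (q i)) q n x))
    \<longlonglongrightarrow> complex_of_real (exp (- (t \<bullet> (C *v t)) / 2))"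
proof -
  interpret G: prob_space G by fact
  note [measurable_cong] = G(2)
  \<comment> \<open>The linearisation of \<open>ln y / q i\<close> at \<open>y = 1\<close>, with
    \<open>y\<close> the power \<open>\<bar>x\<bar> powr q i\<close> relative to its mean. Averaged
    over the coordinates it is the leading term of the logarithm of the norm.\<close>
  define w where "w i x = (\<bar>x\<bar> powr q i / M (q i) - 1) / q i" for i x
  define u where "u t x = (\<Sum>i\<in>UNIV. t $ i * w i x)" for t x
  have intq: "integrable G (\<lambda>x. \<bar>x\<bar> powr q i)" for i
    using q[of i] by (intro int) simp
  have [measurable]: "w i \<in> borel_measurable G" for i unfolding w_def by measurable
  have [measurable]: "u t \<in> borel_measurable G" for t unfolding u_def by measurable
  have prod: "w i x * w j x = (\<bar>x\<bar> powr (q i + q j) / (M (q i) * M (q j)) - \<bar>x\<bar> powr q i / M (q i)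
      - \<bar>x\<bar> powr q j / M (q j) + 1) / (q i * q j)" for i j x
    using pos[of "q i"] pos[of "q j"] q[of i] q[of j]
    by (simp add: w_def powr_add) (simp add: field_simps)
  have int_w: "integrable G (w i)" "(\<integral>x. w i x \<partial>G) = 0" for i
    using intq[of i] M[of "q i"] pos[of "q i"] q[of i] by (simp_all add: w_def[abs_def] G.prob_space)
  have int_ww: "integrable G (\<lambda>x. w i x * w j x)" "(\<integral>x. w i x * w j x \<partial>G) = C $ i $ j" for i j
  proof -
    have i: "integrable G (\<lambda>x. \<bar>x\<bar> powr (q i + q j))"
      using q[of i] q[of j] by (intro int) simp
    show "integrable G (\<lambda>x. w i x * w j x)"
      unfolding prod using i intq by simp
    have "(\<integral>x. w i x * w j x \<partial>G) = (M (q i + q j) / (M (q i) * M (q j)) - M (q i) / M (q i)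
      - M (q j) / M (q j) + 1) / (q i * q j)"
      unfolding prod using i intq M[of "q i"] M[of "q j"] M[of "q i + q j"] q[of i] q[of j]
      by (simp add: G.prob_space)
    then show "(\<integral>x. w i x * w j x \<partial>G) = C $ i $ j"
      using pos[of "q i"] pos[of "q j"] q[of i] q[of j] by (simp add: C field_simps)
  qed
  have usq: "(u t x)\<^sup>2 = (\<Sum>i\<in>UNIV. \<Sum>j\<in>UNIV. t $ i * t $ j * (w i x * w j x))" for t x
    unfolding u_def power2_eq_square sum_product by (intro sum.cong refl) (simp add: ac_simps)
  have int_u: "integrable G (u t)" "(\<integral>x. u t x \<partial>G) = 0" "integrable G (\<lambda>x. (u t x)\<^sup>2)" for t
    using int_w int_ww unfolding usq by (simp_all add: u_def[abs_def])
  have var_u: "(\<integral>x. (u t x)\<^sup>2 \<partial>G) = t \<bullet> (C *v t)" for t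
    unfolding usq using int_ww
    by (simp add: inner_vec_def matrix_vector_mult_def sum_distrib_left ac_simps)
  have clt: "(\<lambda>n. (CLINT x|G. cis (u t x / sqrt (real n))) ^ n) \<longlonglongrightarrow> complex_of_real (exp (- (t \<bullet> (C *v t)) / 2))" for t
    using char_power_tendsto_gaussian[OF G(1) _ int_u(1,3,2), of t] by (simp add: var_u)
  define P where "P n = PiM {..<n} (\<lambda>_::nat. G)" for n
  define S where "S n x = (\<chi> i. (\<Sum>k<n. w i (x k)) / sqrt (real n))" for n :: nat and x :: "nat \<Rightarrow> real"
  define \<mu> where "\<mu> n = distr (P n) borel (S n)" for n
  have P: "prob_space (P n)" for n unfolding P_def by (intro prob_space_PiM G)
  have comp[measurable]: "(\<lambda>x. x k) \<in> borel_measurable (P n)" if "k \<in> {..<n}" for k n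
    using measurable_component_singleton[OF that, of "\<lambda>_. G"] by (simp add: P_def G(2) cong: measurable_cong_sets)
  have w_borel[measurable]: "w i \<in> borel_measurable borel" for i unfolding w_def by measurable
  have S_meas[measurable]: "S n \<in> P n \<rightarrow>\<^sub>M borel" for n unfolding S_def by measurable
  have \<mu>: "prob_space (\<mu> n)" "sets (\<mu> n) = sets borel" for n
    using P by (auto simp: \<mu>_def intro!: prob_space.prob_space_distr)
  have char_\<mu>: "(CLINT x|\<mu> n. cis (t \<bullet> x)) = (CLINT x|G. cis (u t x / sqrt (real n))) ^ n" for n t
  proof -
    have "(CLINT x|\<mu> n. cis (t \<bullet> x)) = (CLINT x|P n. cis (t \<bullet> S n x))"
      unfolding \<mu>_def by (intro integral_distr) auto
    also have "\<dots> = (CLINT x|P n. cis (\<Sum>k<n. u t (x k) / sqrt (real n)))"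
      unfolding S_def u_def inner_vec_def
      by (simp add: sum_distrib_left sum_divide_distrib sum.swap[of _ _ "{..<n}"])
    also have "\<dots> = (\<Prod>k<n. CLINT x|G. cis (u t x / sqrt (real n)))"
      unfolding P_def by (intro integral_PiM_cis_sum G) auto
    finally show ?thesis by simp
  qed
  have psd: "0 \<le> t \<bullet> (C *v t)" for t
    unfolding var_u[symmetric] by simp
  have "\<exists>N. centered_gaussian C N"
    by (intro ex_centered_gaussian psd) (simp add: C add.commute mult.commute)
  then obtain N where N: "centered_gaussian C N" by blast
  then have N': "prob_space N" "sets N = sets borel"
    "\<And>t. (CLINT x|N. cis (t \<bullet> x)) = complex_of_real (exp (- (t \<bullet> (C *v t)) / 2))"
    by (auto simp: centered_gaussian_def)
  have w: "weak_conv_vec \<mu> N"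
    using clt by (intro levy_continuity_vec \<mu> N') (simp add: char_\<mu> N')
  define h where "h n x = (\<chi> i. sqrt (real n) / q i * ln (1 + q i * x $ i / sqrt (real n)))"
    for n :: nat and x :: "real^'d"
  have h_meas[measurable]: "h n \<in> borel_measurable borel" for n unfolding h_def by measurable
  have conv: "weak_conv_vec (\<lambda>n. distr (\<mu> n) borel (h n)) N"
  proof (rule weak_conv_vec_perturb[OF \<mu> N'(1,2) w h_meas])
    fix K e :: real assume "e > 0"
    show "\<forall>\<^sub>F n in sequentially. \<forall>x. norm x \<le> K \<longrightarrow> norm (h n x - x) < e"
      unfolding h_def by (rule uniformly_id_vec[OF _ \<open>e > 0\<close>]) (rule uniformly_id_ln[OF q])
  qed
  \<comment> \<open>An exact identity, not an expansion: all nonlinearity sits in the deterministic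
    map \<open>h n\<close>. It also holds if every coordinate is 0, because
    \<open>ln 0 = 0\<close>.\<close>
  have log: "h n (S n x) = log_norms 0 (\<lambda>i. M (q i)) q n x" if "n > 0" for n x
  proof -
    have "sqrt (real n) / q i * ln (1 + q i * S n x $ i / sqrt (real n)) =
      sqrt (real n) * ln (real n powr (0 - 1 / q i) * lp_norm n (ereal (q i)) x / M (q i) powr (1 / q i))" for i
    proof -
      have p: "M (q i) > 0" "q i > 0" using pos q by auto
      define s where "s = (\<Sum>k<n. \<bar>x k\<bar> powr q i)"
      have s0: "s \<ge> 0" by (auto simp: s_def intro!: sum_nonneg)
      have "(\<Sum>k<n. w i (x k)) = (s / M (q i) - n) / q i"
        by (simp add: s_def w_def sum_subtractf sum_divide_distrib diff_divide_distrib)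
      then have "1 + q i * S n x $ i / sqrt (real n) = s / (n * M (q i))"
        using p that by (simp add: S_def field_simps)
      moreover have "real n powr (0 - 1 / q i) * lp_norm n (ereal (q i)) x / M (q i) powr (1 / q i)
          = (s / (n * M (q i))) powr (1 / q i)"
        using p that s0
        by (simp add: lp_norm_finite s_def[symmetric] powr_minus powr_divide powr_mult divide_simps)
      ultimately show ?thesis by (simp add: ln_powr)
    qed
    then show ?thesis by (simp add: h_def log_norms_def)
  qed
  have "(\<lambda>n. CLINT x|distr (\<mu> n) borel (h n). cis (t \<bullet> x)) \<longlonglongrightarrow> (CLINT x|N. cis (t \<bullet> x))"
    by (rule weak_conv_vec_cis[OF _ _ N'(1,2) conv]) (auto intro!: prob_space.prob_space_distr \<mu> simp: \<mu>(2) cong: measurable_cong_sets)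
  moreover have "\<forall>\<^sub>F n in sequentially. (CLINT x|distr (\<mu> n) borel (h n). cis (t \<bullet> x))
      = (CLINT x|P n. cis (t \<bullet> log_norms 0 (\<lambda>i. M (q i)) q n x))"
    using eventually_gt_at_top[of 0]
  proof eventually_elim
    case (elim n)
    have "(CLINT x|distr (\<mu> n) borel (h n). cis (t \<bullet> x)) = (CLINT x|P n. cis (t \<bullet> h n (S n x)))"
      unfolding \<mu>_def by (simp add: integral_distr)
    then show ?case by (simp only: log[OF elim])
  qed
  ultimately show ?thesis by (simp add: N'(3) P_def tendsto_cong)
qed

subsection \<open>Moments and covariances\<close>

lemma nn_integral_even:
  fixes F :: "real \<Rightarrow> ennreal"
  assumes [measurable]: "F \<in> borel_measurable borel"
  shows "(\<integral>\<^sup>+x. F \<bar>x\<bar> \<partial>lborel) = 2 * (\<integral>\<^sup>+x. F x * indicator {0..} x \<partial>lborel)"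
proof -
  have "(\<integral>\<^sup>+x. F \<bar>x\<bar> \<partial>lborel) = (\<integral>\<^sup>+x. F x * indicator {0..} x + F (- x) * indicator {0..} (- x) \<partial>lborel)"
  proof (rule nn_integral_cong_AE)
    show "AE x in lborel. F \<bar>x\<bar> = F x * indicator {0..} x + F (- x) * indicator {0..} (- x)"
      using AE_lborel_singleton[of 0] by eventually_elim (auto simp: indicator_def abs_if)
  qed
  also have "\<dots> = (\<integral>\<^sup>+x. F x * indicator {0..} x \<partial>lborel) + (\<integral>\<^sup>+x. F (- x) * indicator {0..} (- x) \<partial>lborel)"
    by (intro nn_integral_add) measurable
  also have "(\<integral>\<^sup>+x. F (- x) * indicator {0..} (- x) \<partial>lborel) = (\<integral>\<^sup>+x. F x * indicator {0..} x \<partial>lborel)"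
    by (subst (2) nn_integral_real_affine[where c = "-1" and t = 0]) auto
  finally show ?thesis by (simp add: mult_2)
qed

text \<open>The substitution \<open>u = x powr p / p\<close> reduces this to Euler's integral for
  Gamma at \<open>(r + 1) / p\<close>.\<close>

lemma nn_integral_half_gaussian_moment:
  fixes p r :: real
  assumes "p > 0" "r \<ge> 0"
  shows "(\<integral>\<^sup>+x. ennreal (x powr r * exp (- (x powr p) / p)) * indicator {0..} x \<partial>lborel)
    = ennreal (p powr ((r + 1) / p - 1) * Gamma ((r + 1) / p))"
proof -
  define s where "s = (r + 1) / p"
  have s: "s > 0" using assms by (simp add: s_def)
  define f where "f u = p powr (s - 1) * (u powr (s - 1) / exp u)" for u :: real
  define g where "g x = x powr p / p" for x :: real
  have img: "g ` {0<..} = {0<..}"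
  proof (intro equalityI subsetI)
    fix u :: real assume "u \<in> {0<..}"
    then have "u = g ((p * u) powr (1 / p))" "(p * u) powr (1 / p) \<in> {0<..}"
      using assms by (auto simp: g_def powr_powr)
    then show "u \<in> g ` {0<..}" by blast
  qed (use assms in \<open>auto simp: g_def\<close>)
  \<comment> \<open>The endpoint 0 is removed: on the open half-line \<open>g\<close> is a bijection
    with derivative \<open>x powr (p - 1)\<close>.\<close>
  have fi: "(f has_integral (p powr (s - 1) * Gamma s)) {0<..}"
  proof -
    have "(f has_integral (p powr (s - 1) * Gamma s)) {0..}"
      unfolding f_def by (intro has_integral_mult_right Gamma_integral_real s)
    moreover have "negligible ({0..} - {0<..} :: real set)" "negligible ({0<..} - {0..} :: real set)"
      by (auto intro: negligible_subset[of "{0}"])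
    ultimately show ?thesis by (subst has_integral_spike_set_eq[of _ "{0..}"]) (auto intro: negligible_subset)
  qed
  have "f absolutely_integrable_on {0<..}"
    using fi by (intro nonnegative_absolutely_integrable_1) (auto simp: f_def has_integral_iff)
  then have "(\<lambda>x. \<bar>x powr (p - 1)\<bar> * f (g x)) absolutely_integrable_on {0<..} \<and>
      integral {0<..} (\<lambda>x. \<bar>x powr (p - 1)\<bar> * f (g x)) = p powr (s - 1) * Gamma s"
  proof (subst has_absolute_integral_change_of_variables_1'[where g = g])
    show "(g has_field_derivative x powr (p - 1)) (at x within {0<..})" if "x \<in> {0<..}" for x
      using that assms unfolding g_def by (auto intro!: derivative_eq_intros)
    show "inj_on g {0<..}"
    proof (rule inj_onI)
      fix x y :: real assume xy: "x \<in> {0<..}" "y \<in> {0<..}" and "g x = g y"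
      then have "(x powr p) powr (1 / p) = (y powr p) powr (1 / p)" using assms by (simp add: g_def)
      then show "x = y" using xy assms by (simp add: powr_powr)
    qed
  qed (use fi in \<open>auto simp: img has_integral_iff\<close>)
  then have *: "((\<lambda>x. \<bar>x powr (p - 1)\<bar> * f (g x)) has_integral p powr (s - 1) * Gamma s) {0<..}"
    by (auto simp: has_integral_iff set_lebesgue_integral_eq_integral(1))
  have eq: "\<bar>x powr (p - 1)\<bar> * f (g x) = x powr r * exp (- (x powr p) / p)" if "x > 0" for x
  proof -
    have "p powr (s - 1) * (x powr p / p) powr (s - 1) = (x powr p) powr (s - 1)"
      using that assms by (simp flip: powr_mult)
    also have "x powr (p - 1) * \<dots> = x powr r"
      using that assms by (simp add: powr_powr s_def flip: powr_add) (simp add: field_simps)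
    finally show ?thesis by (simp add: f_def g_def exp_minus field_simps)
  qed
  have "((\<lambda>x. x powr r * exp (- (x powr p) / p)) has_integral p powr (s - 1) * Gamma s) {0<..}"
    by (rule has_integral_eq[OF _ *], rule eq) simp
  then have "(\<integral>\<^sup>+x. indicator {0<..} x * (x powr r * exp (- (x powr p) / p)) \<partial>lborel) = ennreal (p powr (s - 1) * Gamma s)"
    by (intro nn_integral_has_integral_lebesgue) auto
  moreover have "(\<integral>\<^sup>+x. ennreal (x powr r * exp (- (x powr p) / p)) * indicator {0..} x \<partial>lborel)
     = (\<integral>\<^sup>+x. ennreal (indicator {0<..} x * (x powr r * exp (- (x powr p) / p))) \<partial>lborel)"
    by (intro nn_integral_cong) (auto simp: indicator_def)
  ultimately show ?thesis by (simp add: s_def)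
qed

text \<open>The generalised Gaussian law. The factor \<open>1 / p\<close> in the exponent normalises
  the absolute moment of order \<open>p\<close> to 1.\<close>

definition p_gaussian :: "real \<Rightarrow> real measure" where
  "p_gaussian p = density lborel
     (\<lambda>x. ennreal (exp (- (\<bar>x\<bar> powr p) / p) / (2 * p powr (1 / p) * Gamma (1 + 1 / p))))"

lemma sets_p_gaussian[measurable_cong, simp]: "sets (p_gaussian p) = sets borel"
  by (simp add: p_gaussian_def)

lemma Gamma_plus1_real: "z > 0 \<Longrightarrow> Gamma (1 + z :: real) = z * Gamma z"
  using Gamma_plus1[of z] by (auto simp: add.commute nonpos_Ints_def)

lemma Gamma_1_plus_inverse_pos: "p > 0 \<Longrightarrow> Gamma (1 + 1 / p :: real) > 0"
  by (intro Gamma_real_pos) (simp add: add_pos_pos)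

text \<open>This is the origin of \<open>Mp\<close>: for finite \<open>p\<close> its values are the
  absolute moments of the p-Gaussian law.\<close>

lemma p_gaussian_moment_nn:
  assumes "p > 0" "r \<ge> 0"
  shows "(\<integral>\<^sup>+x. ennreal (\<bar>x\<bar> powr r) \<partial>p_gaussian p) = ennreal (Mp (ereal p) r)"
proof -
  define c where "c = 1 / (2 * p powr (1 / p) * Gamma (1 + 1 / p))"
  have c0: "c \<ge> 0" using Gamma_1_plus_inverse_pos[OF assms(1)] by (simp add: c_def)
  have "(\<integral>\<^sup>+x. ennreal (\<bar>x\<bar> powr r) \<partial>p_gaussian p) =
      (\<integral>\<^sup>+x. ennreal c * ennreal (\<bar>x\<bar> powr r * exp (- (\<bar>x\<bar> powr p) / p)) \<partial>lborel)"
    unfolding p_gaussian_def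
    by (subst nn_integral_density) (auto simp: c_def ac_simps simp flip: ennreal_mult')
  also have "\<dots> = ennreal c * (\<integral>\<^sup>+x. ennreal (\<bar>x\<bar> powr r * exp (- (\<bar>x\<bar> powr p) / p)) \<partial>lborel)"
    by (intro nn_integral_cmult) measurable
  also have "(\<integral>\<^sup>+x. ennreal (\<bar>x\<bar> powr r * exp (- (\<bar>x\<bar> powr p) / p)) \<partial>lborel) =
      2 * ennreal (p powr ((r + 1) / p - 1) * Gamma ((r + 1) / p))"
    by (subst nn_integral_even[where F = "\<lambda>x. ennreal (x powr r * exp (- (x powr p) / p))"])
       (simp_all add: nn_integral_half_gaussian_moment[OF assms, simplified])
  also have "ennreal c * (2 * ennreal (p powr ((r + 1) / p - 1) * Gamma ((r + 1) / p))) =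
      ennreal (c * (2 * (p powr ((r + 1) / p - 1) * Gamma ((r + 1) / p))))"
    using c0 by (simp add: ennreal_mult' numeral_mult_ennreal)
  also have "c * (2 * (p powr ((r + 1) / p - 1) * Gamma ((r + 1) / p))) = Mp (ereal p) r"
  proof -
    define a b g A where "a = p powr (r / p)" and "b = p powr (1 / p)" and "g = Gamma (1 + 1 / p)"
      and "A = Gamma ((r + 1) / p)"
    note defs = a_def[symmetric] b_def[symmetric] g_def[symmetric] A_def[symmetric]
    have nz: "a > 0" "b > 0" "g > 0" using assms Gamma_1_plus_inverse_pos by (auto simp: a_def b_def g_def)
    have "p powr ((r + 1) / p - 1) = a * b / p"
      using assms by (simp add: a_def b_def powr_diff add_divide_distrib powr_add)
    moreover have "Gamma (1 + (r + 1) / p) = (r + 1) / p * A"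
      unfolding A_def using assms by (intro Gamma_plus1_real) simp
    ultimately show ?thesis
      using assms nz by (simp add: c_def Mp_def Let_def defs)
  qed
  finally show ?thesis .
qed

lemma Mp_0: "p > 0 \<Longrightarrow> Mp (ereal p) 0 = 1"
  using Gamma_1_plus_inverse_pos[of p] by (simp add: Mp_def Let_def)

lemma Mp_pos: 
  assumes "p > 0" "r \<ge> 0" 
  shows "Mp (ereal p) r > 0"
  using assms Gamma_real_pos[of "1 + 1 / p"] Gamma_real_pos[of "1 + (r + 1) / p"]
  by (simp add: Mp_def Let_def add_pos_pos add_pos_nonneg)

text \<open>The functional equation of Gamma. At \<open>r = 0\<close> and \<open>r = p\<close> it
  gives \<open>M(p) = 1\<close> and \<open>M(2p) = p + 1\<close>; for general \<open>r\<close> it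
  evaluates every covariance with the power \<open>p\<close>.\<close>

lemma Mp_add_self:
  assumes "p > 0" "r \<ge> 0"
  shows "Mp (ereal p) (r + p) = (r + 1) * Mp (ereal p) r"
proof -
  define z where "z = 1 + (r + 1) / p"
  have z: "z > 0" using assms by (simp add: z_def add_pos_pos)
  have 1: "1 + (r + p + 1) / p = 1 + z" using assms by (simp add: z_def field_simps)
  have 2: "p powr ((r + p) / p) = p powr (r / p) * p"
    using assms by (simp add: add_divide_distrib powr_add)
  have 3: "p * z = r + p + 1" using assms by (simp add: z_def field_simps)
  have "Mp (ereal p) (r + p) = p powr (r / p) * p / (r + p + 1) * (z * Gamma z) / Gamma (1 + 1 / p)"
    unfolding Mp_def Let_def by (simp add: 1 2 Gamma_plus1_real[OF z])
  also have "\<dots> = p powr (r / p) * (p * z) / (r + p + 1) * Gamma z / Gamma (1 + 1 / p)" by simp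
  also have "\<dots> = p powr (r / p) * Gamma z / Gamma (1 + 1 / p)"
    unfolding 3 using assms by simp
  finally show ?thesis using assms by (simp add: Mp_def Let_def z_def)
qed

lemma prob_space_p_gaussian: "p > 0 \<Longrightarrow> prob_space (p_gaussian p)"
proof
  assume p: "p > 0"
  have "emeasure (p_gaussian p) (space (p_gaussian p)) = (\<integral>\<^sup>+x. 1 \<partial>p_gaussian p)"
    by simp
  also have "\<dots> = (\<integral>\<^sup>+x. ennreal (\<bar>x\<bar> powr 0) \<partial>p_gaussian p)"
  proof (rule nn_integral_cong_AE)
    \<comment> \<open>\<open>0 powr 0\<close> is 0, so the constant 1 equals the power of exponent 0
      only off the origin.\<close>
    have "AE x in lborel. x \<noteq> (0::real)" by (rule AE_lborel_singleton)
    then have "AE x in p_gaussian p. x \<noteq> 0"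
      unfolding p_gaussian_def by (subst AE_density) auto
    then show "AE x in p_gaussian p. 1 = ennreal (\<bar>x\<bar> powr 0)" by eventually_elim simp
  qed
  also have "\<dots> = 1" using p by (subst p_gaussian_moment_nn) (simp_all add: Mp_0)
  finally show "emeasure (p_gaussian p) (space (p_gaussian p)) = 1" .
qed

lemma p_gaussian_moment:
  assumes "p > 0" "r \<ge> 0"
  shows "integrable (p_gaussian p) (\<lambda>x. \<bar>x\<bar> powr r)" "(\<integral>x. \<bar>x\<bar> powr r \<partial>p_gaussian p) = Mp (ereal p) r"
proof -
  have "has_bochner_integral (p_gaussian p) (\<lambda>x. \<bar>x\<bar> powr r) (Mp (ereal p) r)"
    using p_gaussian_moment_nn[OF assms] Mp_pos[OF assms]
    by (intro has_bochner_integral_nn_integral) auto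
  then show "integrable (p_gaussian p) (\<lambda>x. \<bar>x\<bar> powr r)" "(\<integral>x. \<bar>x\<bar> powr r \<partial>p_gaussian p) = Mp (ereal p) r"
    by (simp_all add: has_bochner_integral_iff)
qed

lemma uniform_cube_moment:
  assumes "r \<ge> 0"
  shows "integrable (uniform_measure lborel {-1..1}) (\<lambda>x::real. \<bar>x\<bar> powr r)"
    "(\<integral>x. \<bar>x\<bar> powr r \<partial>uniform_measure lborel {-1..1::real}) = Mp \<infinity> r"
proof -
  have "(\<integral>\<^sup>+x. ennreal (\<bar>x\<bar> powr r) \<partial>uniform_measure lborel {-1..1::real})
      = (\<integral>\<^sup>+x. ennreal (\<bar>x\<bar> powr r) * indicator {-1..1::real} x \<partial>lborel) / 2"
    by (subst nn_integral_uniform_measure) auto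
  also have "(\<integral>\<^sup>+x. ennreal (\<bar>x\<bar> powr r) * indicator {-1..1::real} x \<partial>lborel)
      = (\<integral>\<^sup>+x. ennreal (\<bar>x\<bar> powr r) * indicator {..1} \<bar>x\<bar> \<partial>lborel)"
    by (intro nn_integral_cong) (auto simp: indicator_def)
  also have "\<dots> = 2 * (\<integral>\<^sup>+x. ennreal (x powr r) * indicator {..1} x * indicator {0..} x \<partial>lborel)"
    by (rule nn_integral_even) measurable
  also have "(\<integral>\<^sup>+x. ennreal (x powr r) * indicator {..1} x * indicator {0..} x \<partial>lborel)
      = (\<integral>\<^sup>+x. ennreal (indicator {0..1} x * x powr r) \<partial>lborel)"
    by (intro nn_integral_cong) (auto simp: indicator_def)
  also have "\<dots> = ennreal (Mp \<infinity> r)"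
    using has_integral_powr_from_0[of r 1] assms
    by (intro nn_integral_has_integral_lebesgue) (auto simp: Mp_def)
  finally have "(\<integral>\<^sup>+x. ennreal (\<bar>x\<bar> powr r) \<partial>uniform_measure lborel {-1..1::real}) = ennreal (Mp \<infinity> r)"
    using assms by (simp add: Mp_def ennreal_times_divide[symmetric] ennreal_mult_divide_eq mult.commute[of 2])
  then have "has_bochner_integral (uniform_measure lborel {-1..1::real}) (\<lambda>x. \<bar>x\<bar> powr r) (Mp \<infinity> r)"
    using assms by (intro has_bochner_integral_nn_integral) (auto simp: Mp_def)
  then show "integrable (uniform_measure lborel {-1..1}) (\<lambda>x::real. \<bar>x\<bar> powr r)"
    "(\<integral>x. \<bar>x\<bar> powr r \<partial>uniform_measure lborel {-1..1::real}) = Mp \<infinity> r"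
    by (simp_all add: has_bochner_integral_iff)
qed

text \<open>The terms involving the exponent \<open>p\<close> collapse:
  \<open>C(p,p) / p^2 = 1 / p\<close>, and both quotients in the last bracket are 1, so they
  contribute \<open>1 / p - 2 / p\<close>.\<close>

lemma cov1_finite:
  assumes p: "p > 0" and r: "r > 0" "s > 0"
  shows "cov1 (ereal p) r s = Cp (ereal p) r s / (r * s * Mp (ereal p) r * Mp (ereal p) s) - 1 / p"
proof -
  have M1: "Mp (ereal p) p = 1" using Mp_add_self[of p 0] p by (simp add: Mp_0)
  then have M2: "Mp (ereal p) (p + p) = p + 1" using Mp_add_self[of p p] p by simp
  have C1: "Cp (ereal p) p p = p" unfolding Cp_def M1 M2 by simp
  have C2: "Cp (ereal p) u p / (u * Mp (ereal p) u) = 1" if "u > 0" for u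
  proof -
    have "Cp (ereal p) u p = u * Mp (ereal p) u"
      using p that Mp_add_self[of p u] by (simp add: Cp_def M1 algebra_simps)
    then show ?thesis using Mp_pos[of p u] p that by simp
  qed
  show ?thesis
    using p r by (simp add: cov1_def C1 C2 power2_eq_square)
qed

text \<open>For finite \<open>p\<close>, the moment is
  \<open>p^(u/p) * Gamma ((u+1)/p) / Gamma (1/p)\<close>; in the quotient of \<open>M(r+s)\<close>
  by \<open>M(r) * M(s)\<close> the powers of \<open>p\<close> cancel.\<close>

lemma cov1_eq_cov2:
  assumes "p > 0" "r > 0" "s > 0"
  shows "cov1 p r s = cov2 p r s"
proof (cases p)
  case PInf
  then show ?thesis
    using assms by (simp add: cov1_def cov2_def Cp_def Mp_def divide_simps) (simp add: algebra_simps)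
next
  case (real p')
  then have p': "p' > 0" using assms by simp
  have M: "Mp (ereal p') u = p' powr (u / p') * (Gamma ((u + 1) / p') / Gamma (1 / p'))" if "u > 0" for u
  proof -
    have "Gamma (1 + (u + 1) / p') = (u + 1) / p' * Gamma ((u + 1) / p')"
      "Gamma (1 + 1 / p') = 1 / p' * Gamma (1 / p')"
      using p' that by (intro Gamma_plus1_real; simp)+
    then have "Mp (ereal p') u = p' powr (u / p') / (u + 1) * ((u + 1) / p' * Gamma ((u + 1) / p')) / (1 / p' * Gamma (1 / p'))"
      unfolding Mp_def Let_def by simp
    then show ?thesis using p' that by simp
  qed
  have g: "Gamma ((u + 1) / p') > 0" if "u > 0" for u using p' that by (intro Gamma_real_pos) simp
  have g1: "Gamma (1 / p') > 0" using p' by (intro Gamma_real_pos) simp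
  have "Cp (ereal p') r s / (r * s * Mp (ereal p') r * Mp (ereal p') s)
      = 1 / (r * s) * (Mp (ereal p') (r + s) / (Mp (ereal p') r * Mp (ereal p') s) - 1)"
    using assms p' Mp_pos[of p' r] Mp_pos[of p' s] by (simp add: Cp_def field_simps)
  also have "Mp (ereal p') (r + s) / (Mp (ereal p') r * Mp (ereal p') s) =
      Gamma (1 / p') * Gamma ((r + s + 1) / p') / (Gamma ((r + 1) / p') * Gamma ((s + 1) / p'))"
    using assms p' g[of r] g[of s] g1 by (simp add: M add_divide_distrib powr_add)
  finally show ?thesis using assms p' by (simp add: real cov1_finite cov2_def Let_def)
qed (use assms in simp)

subsection \<open>Uniform points of balls\<close>

abbreviation lborel_vec :: "nat \<Rightarrow> (nat \<Rightarrow> real) measure" where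
  "lborel_vec n \<equiv> PiM {..<n} (\<lambda>_. lborel)"

text \<open>The restriction keeps the result \<open>undefined\<close> off the index set, hence in
  the space of the product measure.\<close>

definition scale_vec :: "nat \<Rightarrow> real \<Rightarrow> (nat \<Rightarrow> real) \<Rightarrow> nat \<Rightarrow> real" where
  "scale_vec n r x = (\<lambda>i\<in>{..<n}. r * x i)"

interpretation lborel_product: product_sigma_finite "\<lambda>_::nat. lborel :: real measure" ..

interpretation lborel_vec: sigma_finite_measure "lborel_vec n" for n
  by (rule lborel_product.sigma_finite) simp

lemma measurable_scale_vec[measurable]:
  "(\<lambda>(r, x). scale_vec n r x) \<in> borel \<Otimes>\<^sub>M lborel_vec n \<rightarrow>\<^sub>M lborel_vec n"
  unfolding scale_vec_def by measurable

lemma measurable_scale_vec_const[measurable]: "scale_vec n r \<in> lborel_vec n \<rightarrow>\<^sub>M lborel_vec n"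
  unfolding scale_vec_def[abs_def] by measurable

lemma lp_norm_scale_vec:
  assumes "r \<ge> 0" "p \<noteq> 0"
  shows "lp_norm n (ereal p) (scale_vec n r x) = r * lp_norm n (ereal p) x"
proof -
  have "(\<Sum>i<n. \<bar>scale_vec n r x i\<bar> powr p) = r powr p * (\<Sum>i<n. \<bar>x i\<bar> powr p)"
    using assms by (simp add: scale_vec_def abs_mult powr_mult sum_distrib_left)
  then show ?thesis
    using assms by (simp add: lp_norm_finite powr_mult powr_powr sum_nonneg)
qed

text \<open>Boxes determine the product measure, and on a box each of the \<open>n\<close> factors
  contributes one \<open>r\<close>.\<close>

lemma lborel_vec_scale:
  assumes "r > 0"
  shows "lborel_vec n = density (distr (lborel_vec n) (lborel_vec n) (scale_vec n r)) (\<lambda>_. ennreal (r ^ n))"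
proof (rule lborel_product.PiM_eqI[symmetric])
  fix A :: "nat \<Rightarrow> real set" assume A: "\<And>i. i \<in> {..<n} \<Longrightarrow> A i \<in> sets lborel"
  have scale: "ennreal r * emeasure lborel {x. r * x \<in> A i} = emeasure lborel (A i)" if "i \<in> {..<n}" for i
  proof -
    have [measurable]: "A i \<in> sets borel" using A[OF that] by simp
    have "emeasure lborel (A i) = (\<integral>\<^sup>+x. indicator (A i) x \<partial>lborel)" by simp
    also have "\<dots> = ennreal r * (\<integral>\<^sup>+x. indicator (A i) (0 + r * x) \<partial>lborel)"
      using assms by (subst nn_integral_real_affine[where c = r and t = 0]) auto
    also have "(\<integral>\<^sup>+x. indicator (A i) (0 + r * x) \<partial>lborel) = (\<integral>\<^sup>+x. indicator {x. r * x \<in> A i} x \<partial>lborel)"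
      by (intro nn_integral_cong) (auto simp: indicator_def)
    finally show ?thesis by simp
  qed
  have meas: "{x. r * x \<in> A i} \<in> sets lborel" if "i \<in> {..<n}" for i
  proof -
    have [measurable]: "A i \<in> sets borel" using A[OF that] by simp
    show ?thesis by simp
  qed
  have box[measurable]: "Pi\<^sub>E {..<n} A \<in> sets (lborel_vec n)" by (intro sets_PiM_I_finite A) auto
  have vimage: "scale_vec n r -` Pi\<^sub>E {..<n} A \<inter> space (lborel_vec n) = (\<Pi>\<^sub>E i\<in>{..<n}. {x. r * x \<in> A i})"
  proof (rule set_eqI)
    fix x
    have "scale_vec n r x \<in> Pi\<^sub>E {..<n} A \<longleftrightarrow> (\<forall>i<n. r * x i \<in> A i)"
      by (auto simp: scale_vec_def PiE_iff)
    then show "x \<in> scale_vec n r -` Pi\<^sub>E {..<n} A \<inter> space (lborel_vec n) \<longleftrightarrow> x \<in> (\<Pi>\<^sub>E i\<in>{..<n}. {x. r * x \<in> A i})"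
      by (auto simp: space_PiM PiE_iff)
  qed
  have "emeasure (density (distr (lborel_vec n) (lborel_vec n) (scale_vec n r)) (\<lambda>_. ennreal (r ^ n))) (Pi\<^sub>E {..<n} A)
    = ennreal (r ^ n) * emeasure (distr (lborel_vec n) (lborel_vec n) (scale_vec n r)) (Pi\<^sub>E {..<n} A)"
    by (intro emeasure_density_const) simp
  also have "\<dots> = ennreal (r ^ n) * (\<Prod>i<n. emeasure lborel {x. r * x \<in> A i})"
    by (subst emeasure_distr) (simp_all add: vimage, subst lborel_product.emeasure_PiM, use meas in auto)
  also have "\<dots> = (\<Prod>i<n. ennreal r * emeasure lborel {x. r * x \<in> A i})"
    using assms by (simp add: prod.distrib ennreal_power)
  also have "\<dots> = (\<Prod>i<n. emeasure lborel (A i))" by (intro prod.cong scale) auto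
  finally show "emeasure (density (distr (lborel_vec n) (lborel_vec n) (scale_vec n r)) (\<lambda>_. ennreal (r ^ n))) (Pi\<^sub>E {..<n} A)
    = (\<Prod>i\<in>{..<n}. emeasure lborel (A i))" .
qed auto

lemma nn_integral_scale_vec:
  assumes "r > 0" and [measurable]: "F \<in> borel_measurable (lborel_vec n)"
  shows "(\<integral>\<^sup>+x. F x \<partial>lborel_vec n) = ennreal (r ^ n) * (\<integral>\<^sup>+x. F (scale_vec n r x) \<partial>lborel_vec n)"
  by (subst lborel_vec_scale[OF assms(1)])
     (simp add: nn_integral_density nn_integral_distr nn_integral_cmult)

lemma PiM_density:
  assumes [measurable]: "g \<in> borel_measurable borel" and "prob_space (density lborel g)"
  shows "PiM {..<n} (\<lambda>_. density lborel g) = density (lborel_vec n) (\<lambda>x. \<Prod>i<n. g (x i) :: ennreal)"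
proof -
  interpret G: prob_space "density lborel g" by fact
  interpret product_sigma_finite "\<lambda>_::nat. density lborel g" ..
  show ?thesis
  proof (rule PiM_eqI[symmetric])
    show "sets (density (lborel_vec n) (\<lambda>x. \<Prod>i<n. g (x i))) = sets (PiM {..<n} (\<lambda>_. density lborel g))"
      by (simp cong: sets_PiM_cong)
    fix A :: "nat \<Rightarrow> real set" assume "\<And>i. i \<in> {..<n} \<Longrightarrow> A i \<in> sets (density lborel g)"
    then have A: "i \<in> {..<n} \<Longrightarrow> A i \<in> sets borel" for i by simp
    then have box: "Pi\<^sub>E {..<n} A \<in> sets (lborel_vec n)" by (intro sets_PiM_I_finite) auto
    have "emeasure (density (lborel_vec n) (\<lambda>x. \<Prod>i<n. g (x i))) (Pi\<^sub>E {..<n} A)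
      = (\<integral>\<^sup>+x. (\<Prod>i<n. g (x i)) * indicator (Pi\<^sub>E {..<n} A) x \<partial>lborel_vec n)"
      by (rule emeasure_density[OF _ box]) measurable
    also have "\<dots> = (\<integral>\<^sup>+x. (\<Prod>i<n. g (x i) * indicator (A i) (x i)) \<partial>lborel_vec n)"
    proof (rule nn_integral_cong)
      fix x assume x: "x \<in> space (lborel_vec n)"
      have "indicator (Pi\<^sub>E {..<n} A) x = (\<Prod>i<n. indicator (A i) (x i) :: ennreal)"
      proof (cases "x \<in> Pi\<^sub>E {..<n} A")
        case True
        then show ?thesis by (auto simp: PiE_iff intro!: prod.neutral[symmetric])
      next
        case False
        then obtain i where "i < n" "x i \<notin> A i" using x by (auto simp: space_PiM PiE_iff)
        then have "(\<Prod>i<n. indicator (A i) (x i) :: ennreal) = 0" by (intro prod_zero bexI[of _ i]) auto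
        then show ?thesis using False by simp
      qed
      then show "(\<Prod>i<n. g (x i)) * indicator (Pi\<^sub>E {..<n} A) x = (\<Prod>i<n. g (x i) * indicator (A i) (x i))"
        by (simp add: prod.distrib)
    qed
    also have "\<dots> = (\<Prod>i<n. \<integral>\<^sup>+x. g x * indicator (A i) x \<partial>lborel)"
      using A by (intro lborel_product.product_nn_integral_prod) auto
    also have "\<dots> = (\<Prod>i<n. emeasure (density lborel g) (A i))"
      using A by (intro prod.cong refl) (simp add: emeasure_density)
    finally show "emeasure (density (lborel_vec n) (\<lambda>x. \<Prod>i<n. g (x i))) (Pi\<^sub>E {..<n} A)
      = (\<Prod>i\<in>{..<n}. emeasure (density lborel g) (A i))" .
  qed simp
qed

text \<open>A convenient null hyperplane: off it all norms are positive, so logarithms of norms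
  behave well.\<close>

lemma AE_lborel_vec_nonzero: "n > 0 \<Longrightarrow> AE x in lborel_vec n. x 0 \<noteq> 0"
proof (rule AE_I)
  assume n: "n > 0"
  let ?N = "\<Pi>\<^sub>E i\<in>{..<n}. if i = 0 then {0::real} else UNIV"
  show "?N \<in> sets (lborel_vec n)" by (intro sets_PiM_I_finite) auto
  show "{x \<in> space (lborel_vec n). \<not> x 0 \<noteq> 0} \<subseteq> ?N" by (auto simp: space_PiM PiE_def)
  have "emeasure (lborel_vec n) ?N = (\<Prod>i<n. emeasure lborel (if i = 0 then {0::real} else UNIV))"
    by (intro lborel_product.emeasure_PiM) auto
  also have "\<dots> = 0" using n by (intro prod_zero) (auto intro!: bexI[of _ 0])
  finally show "emeasure (lborel_vec n) ?N = 0" .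
qed

lemma lp_norm_pos:
  assumes "n > 0" "x 0 \<noteq> 0"
  shows "lp_norm n (ereal p) x > 0"
proof -
  have "0 < \<bar>x 0\<bar> powr p" using assms by simp
  also have "\<dots> \<le> (\<Sum>i<n. \<bar>x i\<bar> powr p)"
    using assms by (intro member_le_sum) auto
  finally show ?thesis by (simp add: lp_norm_finite)
qed

lemma sets_lp_ball[measurable]: "lp_ball n p \<in> sets (lborel_vec n)"
  unfolding lp_ball_def by measurable

lemma sets_unif_lp_ball[simp, measurable_cong]: "sets (unif_lp_ball n p) = sets (lborel_vec n)"
  by (simp add: unif_lp_ball_def)

lemma AE_unif_lp_ball_nonzero: "n > 0 \<Longrightarrow> AE x in unif_lp_ball n p. x 0 \<noteq> 0"
  unfolding unif_lp_ball_def
  by (intro AE_uniform_measureI sets_lp_ball) (use AE_lborel_vec_nonzero[of n] in auto)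

lemma radial_layer:
  assumes "p > 0" "a > 0"
  shows "(\<integral>\<^sup>+r. ennreal (r powr (p - 1) * exp (- (r powr p) / p)) * indicator {a..} r \<partial>lborel)
    = ennreal (exp (- (a powr p) / p))"
proof -
  have "(\<integral>\<^sup>+r. ennreal (r powr (p - 1) * exp (- (r powr p) / p)) * indicator {a..} r \<partial>lborel)
    = ennreal (0 - - exp (- (a powr p) / p))"
  proof (rule nn_integral_FTC_atLeast)
    show "((\<lambda>x. - exp (- (x powr p) / p)) has_real_derivative x powr (p - 1) * exp (- (x powr p) / p)) (at x)"
      if "a \<le> x" for x
      using that assms by (auto intro!: derivative_eq_intros)
    show "((\<lambda>x. - exp (- (x powr p) / p)) \<longlongrightarrow> 0) at_top"
      using assms by real_asymp
  qed auto
  then show ?thesis by simp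
qed

text \<open>By \<open>radial_layer\<close> the density \<open>exp (- norm x ^ p / p)\<close> is a mixture of indicators
  of balls, so a vector with i.i.d. \<open>p\<close>-Gaussian entries is a uniform point of the unit ball times
  an independent radius with the following law.\<close>

definition radial_law :: "real \<Rightarrow> nat \<Rightarrow> real measure" where
  "radial_law p n = density lborel (\<lambda>r. emeasure (lborel_vec n) (lp_ball n (ereal p)) *
     (ennreal (r ^ n * (r powr (p - 1) * exp (- (r powr p) / p)) / (2 * p powr (1 / p) * Gamma (1 + 1 / p)) ^ n)
       * indicator {0<..} r))"

text \<open>A layer-cake argument in place of polar coordinates, so no surface measure appears.
  After exchanging the integrals, scaling by \<open>r\<close> maps the unit ball to the ball of
  radius \<open>r\<close> and produces the factor \<open>r ^ n\<close>.\<close>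

lemma nn_integral_p_gaussian_vec:
  assumes p: "p > 0" and n: "n > 0" and [measurable]: "F \<in> borel_measurable (lborel_vec n)"
  shows "(\<integral>\<^sup>+x. F x \<partial>PiM {..<n} (\<lambda>_. p_gaussian p)) =
    (\<integral>\<^sup>+r. ennreal (r ^ n * (r powr (p - 1) * exp (- (r powr p) / p)) / (2 * p powr (1 / p) * Gamma (1 + 1 / p)) ^ n)
        * indicator {0<..} r * (\<integral>\<^sup>+x. F (scale_vec n r x) * indicator (lp_ball n (ereal p)) x \<partial>lborel_vec n) \<partial>lborel)"
proof -
  let ?L = "lborel_vec n" and ?N = "lp_norm n (ereal p)"
  interpret pair_sigma_finite lborel ?L ..
  have [measurable]: "?N \<in> borel_measurable ?L" by (simp add: borel_measurable_lp_norm)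
  define c where "c = 2 * p powr (1 / p) * Gamma (1 + 1 / p)"
  have c: "c > 0" using p Gamma_1_plus_inverse_pos[OF p] by (simp add: c_def)
  define k where "k r = r powr (p - 1) * exp (- (r powr p) / p)" for r :: real
  have k0: "k r \<ge> 0" for r by (simp add: k_def)
  have [measurable]: "k \<in> borel_measurable borel" unfolding k_def by measurable
  have dens: "PiM {..<n} (\<lambda>_. p_gaussian p) = density ?L (\<lambda>x. ennreal (exp (- (?N x powr p) / p) / c ^ n))"
  proof -
    have "PiM {..<n} (\<lambda>_. p_gaussian p) = density ?L (\<lambda>x. \<Prod>i<n. ennreal (exp (- (\<bar>x i\<bar> powr p) / p) / c))"
      using prob_space_p_gaussian[OF p] unfolding p_gaussian_def c_def by (intro PiM_density) auto
    also have "(\<lambda>x. \<Prod>i<n. ennreal (exp (- (\<bar>x i\<bar> powr p) / p) / c)) = (\<lambda>x. ennreal (exp (- (?N x powr p) / p) / c ^ n))"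
    proof
      fix x :: "nat \<Rightarrow> real"
      have "?N x powr p = (\<Sum>i<n. \<bar>x i\<bar> powr p)"
        using p by (simp add: lp_norm_finite powr_powr sum_nonneg)
      then show "(\<Prod>i<n. ennreal (exp (- (\<bar>x i\<bar> powr p) / p) / c)) = ennreal (exp (- (?N x powr p) / p) / c ^ n)"
        using c by (simp add: prod_ennreal prod_dividef exp_sum[symmetric] sum_negf sum_divide_distrib)
    qed
    finally show ?thesis .
  qed
  have "(\<integral>\<^sup>+x. F x \<partial>PiM {..<n} (\<lambda>_. p_gaussian p)) = (\<integral>\<^sup>+x. ennreal (exp (- (?N x powr p) / p) / c ^ n) * F x \<partial>?L)"
    unfolding dens by (intro nn_integral_density) measurable
  \<comment> \<open>\<open>radial_layer\<close> at \<open>a = ?N x\<close> replaces the exponential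
    by an integral over the radii \<open>r \<ge> ?N x\<close>. It requires a positive norm, so the
    null hyperplane is set aside.\<close>
  also have "\<dots> = (\<integral>\<^sup>+x. (\<integral>\<^sup>+r. ennreal (k r / c ^ n) * indicator {0<..} r * (F x * indicator {..r} (?N x)) \<partial>lborel) \<partial>?L)"
  proof (rule nn_integral_cong_AE)
    show "AE x in ?L. ennreal (exp (- (?N x powr p) / p) / c ^ n) * F x =
       (\<integral>\<^sup>+r. ennreal (k r / c ^ n) * indicator {0<..} r * (F x * indicator {..r} (?N x)) \<partial>lborel)"
      using AE_lborel_vec_nonzero[OF n]
    proof eventually_elim
      case (elim x)
      have N: "?N x > 0" using n elim by (rule lp_norm_pos)
      have "(\<integral>\<^sup>+r. ennreal (k r / c ^ n) * indicator {0<..} r * (F x * indicator {..r} (?N x)) \<partial>lborel)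
        = (\<integral>\<^sup>+r. (ennreal (1 / c ^ n) * F x) * (ennreal (k r) * indicator {?N x..} r) \<partial>lborel)"
      proof (rule nn_integral_cong)
        fix r :: real
        have "ennreal (k r / c ^ n) = ennreal (1 / c ^ n) * ennreal (k r)"
          using c k0[of r] by (simp flip: ennreal_mult')
        moreover have "indicator {0<..} r * indicator {..r} (?N x) = (indicator {?N x..} r :: ennreal)"
          using N by (auto simp: indicator_def)
        ultimately show "ennreal (k r / c ^ n) * indicator {0<..} r * (F x * indicator {..r} (?N x))
          = (ennreal (1 / c ^ n) * F x) * (ennreal (k r) * indicator {?N x..} r)"
          by (metis (no_types, opaque_lifting) mult.assoc mult.left_commute)
      qed
      also have "\<dots> = (ennreal (1 / c ^ n) * F x) * (\<integral>\<^sup>+r. ennreal (k r) * indicator {?N x..} r \<partial>lborel)"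
        by (intro nn_integral_cmult) measurable
      also have "(\<integral>\<^sup>+r. ennreal (k r) * indicator {?N x..} r \<partial>lborel) = ennreal (exp (- (?N x powr p) / p))"
        unfolding k_def by (rule radial_layer[OF p N])
      also have "ennreal (1 / c ^ n) * F x * ennreal (exp (- (?N x powr p) / p))
          = ennreal (exp (- (?N x powr p) / p) / c ^ n) * F x"
        using c by (simp add: ac_simps flip: ennreal_mult')
      finally show ?case by simp
    qed
  qed
  also have "\<dots> = (\<integral>\<^sup>+r. (\<integral>\<^sup>+x. ennreal (k r / c ^ n) * indicator {0<..} r * (F x * indicator {..r} (?N x)) \<partial>?L) \<partial>lborel)"
    by (rule Fubini') (simp only: atMost_iff indicator_simps measurable_split_conv indicator_def[of "{.._}"], measurable)
  also have "\<dots> = (\<integral>\<^sup>+r. ennreal (r ^ n * k r / c ^ n) * indicator {0<..} r *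
      (\<integral>\<^sup>+x. F (scale_vec n r x) * indicator (lp_ball n (ereal p)) x \<partial>?L) \<partial>lborel)"
  proof (rule nn_integral_cong)
    fix r :: real
    show "(\<integral>\<^sup>+x. ennreal (k r / c ^ n) * indicator {0<..} r * (F x * indicator {..r} (?N x)) \<partial>?L) =
      ennreal (r ^ n * k r / c ^ n) * indicator {0<..} r *
      (\<integral>\<^sup>+x. F (scale_vec n r x) * indicator (lp_ball n (ereal p)) x \<partial>?L)"
    proof (cases "r > 0")
      case True
      have "(\<integral>\<^sup>+x. ennreal (k r / c ^ n) * indicator {0<..} r * (F x * indicator {..r} (?N x)) \<partial>?L) =
        ennreal (k r / c ^ n) * (\<integral>\<^sup>+x. F x * indicator {..r} (?N x) \<partial>?L)"
        using True by (simp add: nn_integral_cmult)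
      also have "(\<integral>\<^sup>+x. F x * indicator {..r} (?N x) \<partial>?L) =
          ennreal (r ^ n) * (\<integral>\<^sup>+x. F (scale_vec n r x) * indicator {..r} (?N (scale_vec n r x)) \<partial>?L)"
        by (rule nn_integral_scale_vec[OF True]) measurable
      also have "(\<integral>\<^sup>+x. F (scale_vec n r x) * indicator {..r} (?N (scale_vec n r x)) \<partial>?L) =
          (\<integral>\<^sup>+x. F (scale_vec n r x) * indicator (lp_ball n (ereal p)) x \<partial>?L)"
        using True p by (intro nn_integral_cong) (auto simp: indicator_def lp_norm_scale_vec lp_ball_def)
      also have "ennreal (k r / c ^ n) * (ennreal (r ^ n) * (\<integral>\<^sup>+x. F (scale_vec n r x) * indicator (lp_ball n (ereal p)) x \<partial>?L))
        = ennreal (r ^ n * k r / c ^ n) * (\<integral>\<^sup>+x. F (scale_vec n r x) * indicator (lp_ball n (ereal p)) x \<partial>?L)"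
        using True c k0[of r] by (simp add: ac_simps flip: ennreal_mult' mult.assoc)
      finally show ?thesis using True by simp
    qed simp
  qed
  finally show ?thesis by (simp add: k_def c_def)
qed

text \<open>With \<open>F = 1\<close> the preceding formula says that the volume times a radial
  integral is the total mass 1. This excludes the volumes 0 and \<infinity>, and it is also the
  normalisation of \<open>radial_law\<close>.\<close>

lemma emeasure_lp_ball:
  assumes p: "p > 0" and n: "n > 0"
  shows "emeasure (lborel_vec n) (lp_ball n (ereal p)) \<noteq> 0" (is "?B \<noteq> 0")
    "emeasure (lborel_vec n) (lp_ball n (ereal p)) \<noteq> \<infinity>"
    "prob_space (radial_law p n)"
proof -
  let ?K = "\<lambda>r. ennreal (r ^ n * (r powr (p - 1) * exp (- (r powr p) / p)) / (2 * p powr (1 / p) * Gamma (1 + 1 / p)) ^ n)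
        * indicator {0<..} r"
  interpret P: prob_space "PiM {..<n} (\<lambda>_. p_gaussian p)"
    by (intro prob_space_PiM prob_space_p_gaussian p)
  have "1 = (\<integral>\<^sup>+x. 1 \<partial>PiM {..<n} (\<lambda>_. p_gaussian p))"
    by (simp add: P.emeasure_space_1)
  also have "\<dots> = (\<integral>\<^sup>+r. ?K r * ?B \<partial>lborel)"
    by (subst nn_integral_p_gaussian_vec[OF p n]) auto
  finally have 1: "(\<integral>\<^sup>+r. ?K r * ?B \<partial>lborel) = 1" by simp
  also have "(\<integral>\<^sup>+r. ?K r * ?B \<partial>lborel) = (\<integral>\<^sup>+r. ?K r \<partial>lborel) * ?B"
    by (intro nn_integral_multc) measurable
  finally have *: "(\<integral>\<^sup>+r. ?K r \<partial>lborel) * ?B = 1" .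
  show "?B \<noteq> 0" using * by auto
  show "?B \<noteq> \<infinity>" using * by (auto simp: ennreal_mult_top split: if_splits)
  show "prob_space (radial_law p n)"
    by (rule prob_spaceI) (use 1 in \<open>simp add: radial_law_def emeasure_density mult.commute[of ?B]\<close>)
qed

lemma AE_radial_law_pos: "AE r in radial_law p n. r > 0"
  unfolding radial_law_def by (subst AE_density) (auto simp: indicator_def)

lemma p_gaussian_vec_eq_radial:
  assumes p: "p > 0" and n: "n > 0"
  shows "PiM {..<n} (\<lambda>_. p_gaussian p) =
    distr (radial_law p n \<Otimes>\<^sub>M unif_lp_ball n (ereal p)) (lborel_vec n) (\<lambda>(r, x). scale_vec n r x)"
proof (rule measure_eqI)
  show "sets (PiM {..<n} (\<lambda>_. p_gaussian p)) =
    sets (distr (radial_law p n \<Otimes>\<^sub>M unif_lp_ball n (ereal p)) (lborel_vec n) (\<lambda>(r, x). scale_vec n r x))"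
    by (simp cong: sets_PiM_cong)
  fix A assume "A \<in> sets (PiM {..<n} (\<lambda>_. p_gaussian p))"
  then have [measurable]: "A \<in> sets (lborel_vec n)" by (simp cong: sets_PiM_cong)
  have sr: "sets (radial_law p n) = sets borel" by (simp add: radial_law_def)
  note [measurable_cong] = sr
  let ?B = "emeasure (lborel_vec n) (lp_ball n (ereal p))"
  let ?K = "\<lambda>r. ennreal (r ^ n * (r powr (p - 1) * exp (- (r powr p) / p)) / (2 * p powr (1 / p) * Gamma (1 + 1 / p)) ^ n)
        * indicator {0<..} r"
  interpret U: prob_space "unif_lp_ball n (ereal p)"
    unfolding unif_lp_ball_def by (rule prob_space_uniform_measure) (use emeasure_lp_ball[OF p n] in auto)
  have "emeasure (PiM {..<n} (\<lambda>_. p_gaussian p)) A = (\<integral>\<^sup>+x. indicator A x \<partial>PiM {..<n} (\<lambda>_. p_gaussian p))"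
    using \<open>A \<in> sets (PiM {..<n} (\<lambda>_. p_gaussian p))\<close> by simp
  also have "\<dots> = (\<integral>\<^sup>+r. ?K r * (\<integral>\<^sup>+x. indicator A (scale_vec n r x) * indicator (lp_ball n (ereal p)) x \<partial>lborel_vec n) \<partial>lborel)"
    by (rule nn_integral_p_gaussian_vec[OF p n]) simp
  also have "\<dots> = (\<integral>\<^sup>+r. (?B * ?K r) * (\<integral>\<^sup>+x. indicator A (scale_vec n r x) \<partial>unif_lp_ball n (ereal p)) \<partial>lborel)"
  proof (rule nn_integral_cong)
    fix r :: real
    let ?I = "\<integral>\<^sup>+x. indicator A (scale_vec n r x) * indicator (lp_ball n (ereal p)) x \<partial>lborel_vec n"
    have "(\<integral>\<^sup>+x. indicator A (scale_vec n r x) \<partial>unif_lp_ball n (ereal p)) = ?I / ?B"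
      unfolding unif_lp_ball_def by (rule nn_integral_uniform_measure) measurable
    \<comment> \<open>The factor \<open>?B\<close> in \<open>radial_law\<close> undoes the
      normalisation of the uniform law; cancelling uses that the volume is neither 0 nor
      \<infinity>.\<close>
    moreover have "?B * (?I / ?B) = ?I"
      using emeasure_lp_ball[OF p n] by (simp add: ennreal_times_divide ennreal_mult_divide_eq mult.commute[of ?B])
    ultimately have "?K r * ?I = ?K r * (?B * (\<integral>\<^sup>+x. indicator A (scale_vec n r x) \<partial>unif_lp_ball n (ereal p)))"
      by (simp only:)
    then show "?K r * ?I = (?B * ?K r) * (\<integral>\<^sup>+x. indicator A (scale_vec n r x) \<partial>unif_lp_ball n (ereal p))"
      by (simp only: ac_simps)
  qed
  also have "\<dots> = (\<integral>\<^sup>+r. (\<integral>\<^sup>+x. indicator A (scale_vec n r x) \<partial>unif_lp_ball n (ereal p)) \<partial>radial_law p n)"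
    unfolding radial_law_def by (subst nn_integral_density) measurable
  also have "\<dots> = (\<integral>\<^sup>+z. indicator A (case z of (r, x) \<Rightarrow> scale_vec n r x) \<partial>(radial_law p n \<Otimes>\<^sub>M unif_lp_ball n (ereal p)))"
    by (subst U.nn_integral_fst[symmetric]) auto
  also have "\<dots> = emeasure (distr (radial_law p n \<Otimes>\<^sub>M unif_lp_ball n (ereal p)) (lborel_vec n) (\<lambda>(r, x). scale_vec n r x)) A"
  proof -
    have "(\<lambda>(r, x). scale_vec n r x) \<in> radial_law p n \<Otimes>\<^sub>M unif_lp_ball n (ereal p) \<rightarrow>\<^sub>M lborel_vec n"
      using measurable_scale_vec by (simp only: measurable_cong_sets[OF sets_pair_measure_cong[OF sr sets_unif_lp_ball] refl])
    then show ?thesis by (subst nn_integral_indicator[symmetric], simp) (subst nn_integral_distr; simp)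
  qed
  finally show "emeasure (PiM {..<n} (\<lambda>_. p_gaussian p)) A =
    emeasure (distr (radial_law p n \<Otimes>\<^sub>M unif_lp_ball n (ereal p)) (lborel_vec n) (\<lambda>(r, x). scale_vec n r x)) A" .
qed

text \<open>By homogeneity the ball of radius \<open>a\<close> is the unit ball scaled by
  \<open>a\<close>, and volume scales with \<open>a ^ n\<close>.\<close>

lemma prob_unif_lp_ball_norm_le:
  assumes p: "p > 0" and n: "n > 0" and a: "0 < a" "a \<le> 1"
  shows "measure (unif_lp_ball n (ereal p)) {x \<in> space (lborel_vec n). lp_norm n (ereal p) x \<le> a} = a ^ n"
proof -
  let ?L = "lborel_vec n" and ?N = "lp_norm n (ereal p)"
  have [measurable]: "?N \<in> borel_measurable ?L" by (simp add: borel_measurable_lp_norm)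
  let ?B = "emeasure ?L (lp_ball n (ereal p))" and ?S = "{x \<in> space ?L. ?N x \<le> a}"
  have "emeasure ?L ?S = (\<integral>\<^sup>+x. indicator ?S x \<partial>?L)" by simp
  also have "\<dots> = ennreal (a ^ n) * (\<integral>\<^sup>+x. indicator ?S (scale_vec n a x) \<partial>?L)"
    by (rule nn_integral_scale_vec[OF a(1)]) measurable
  also have "(\<integral>\<^sup>+x. indicator ?S (scale_vec n a x) \<partial>?L) = (\<integral>\<^sup>+x. indicator (lp_ball n (ereal p)) x \<partial>?L)"
    using a p measurable_space[OF measurable_scale_vec_const[of n a]]
    by (intro nn_integral_cong) (auto simp: indicator_def lp_norm_scale_vec lp_ball_def)
  finally have S: "emeasure ?L ?S = ennreal (a ^ n) * ?B" by simp
  have "emeasure (unif_lp_ball n (ereal p)) ?S = emeasure ?L (lp_ball n (ereal p) \<inter> ?S) / ?B"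
    unfolding unif_lp_ball_def by (rule emeasure_uniform_measure) measurable
  also have "lp_ball n (ereal p) \<inter> ?S = ?S" using a by (auto simp: lp_ball_def)
  also have "emeasure ?L ?S / ?B = ennreal (a ^ n)"
    unfolding S using emeasure_lp_ball[OF p n] by (simp add: ennreal_mult_divide_eq)
  finally show ?thesis using a by (simp add: measure_def)
qed

subsection \<open>The limit law\<close>

lemma sets_radial_law[simp, measurable_cong]: "sets (radial_law p n) = sets borel"
  by (simp add: radial_law_def)

section \<open>The uniform law as a probability measure, and the cube as a product\<close>

lemma emeasure_PiM_interval:
  "emeasure (lborel_vec n) (\<Pi>\<^sub>E i\<in>{..<n}. {-1..1}) = 2 ^ n"
  by (subst lborel_product.emeasure_PiM) auto

lemma lp_ball_infinity: "lp_ball n \<infinity> = (\<Pi>\<^sub>E i\<in>{..<n}. {-1..1})"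
proof (rule set_eqI)
  fix x :: "nat \<Rightarrow> real"
  have "lp_norm n \<infinity> x \<le> 1 \<longleftrightarrow> (\<forall>i<n. \<bar>x i\<bar> \<le> 1)"
    by (auto simp: lp_norm_def)
  then show "x \<in> lp_ball n \<infinity> \<longleftrightarrow> x \<in> (\<Pi>\<^sub>E i\<in>{..<n}. {-1..1})"
    by (auto simp: lp_ball_def space_PiM PiE_iff abs_le_iff)
qed

lemma prob_space_unif_lp_ball:
  assumes "1 \<le> p"
  shows "prob_space (unif_lp_ball n p)"
proof -
  have "emeasure (lborel_vec n) (lp_ball n p) \<noteq> 0 \<and> emeasure (lborel_vec n) (lp_ball n p) \<noteq> \<infinity>"
  proof (cases "p = \<infinity>")
    case True
    then show ?thesis by (simp add: lp_ball_infinity emeasure_PiM_interval power_eq_top_ennreal)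
  next
    case False
    then obtain p' where p: "p = ereal p'" "p' \<ge> 1" using assms by (cases p) auto
    show ?thesis
    proof (cases "n = 0")
      case True
      \<comment> \<open>For \<open>n = 0\<close> the space is a single point, of norm 0 and measure
        1.\<close>
      have "lp_ball n p = {\<lambda>_. undefined}"
        using p True by (auto simp: lp_ball_def space_PiM lp_norm_finite)
      then show ?thesis using True by (simp add: PiM_empty)
    next
      case False
      then show ?thesis using emeasure_lp_ball[of p' n] p by simp
    qed
  qed
  then show ?thesis
    unfolding unif_lp_ball_def by (intro prob_space_uniform_measure) auto
qed

lemma unif_lp_ball_infinity:
  "unif_lp_ball n \<infinity> = PiM {..<n} (\<lambda>_. uniform_measure lborel {-1..1})"
proof -
  interpret G: prob_space "uniform_measure lborel {-1..1::real}"
    by (rule prob_space_uniform_measure) auto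
  interpret product_sigma_finite "\<lambda>_::nat. uniform_measure lborel {-1..1::real}" ..
  show ?thesis
  proof (rule PiM_eqI)
    show "sets (unif_lp_ball n \<infinity>) = sets (PiM {..<n} (\<lambda>_. uniform_measure lborel {-1..1}))"
      by (simp cong: sets_PiM_cong)
    fix A :: "nat \<Rightarrow> real set" assume "\<And>i. i \<in> {..<n} \<Longrightarrow> A i \<in> sets (uniform_measure lborel {-1..1})"
    then have A: "i \<in> {..<n} \<Longrightarrow> A i \<in> sets borel" for i by simp
    have box: "Pi\<^sub>E {..<n} A \<in> sets (lborel_vec n)" using A by (intro sets_PiM_I_finite) auto
    have "emeasure (unif_lp_ball n \<infinity>) (Pi\<^sub>E {..<n} A)
      = emeasure (lborel_vec n) (\<Pi>\<^sub>E i\<in>{..<n}. {-1..1} \<inter> A i) / 2 ^ n"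
      unfolding unif_lp_ball_def emeasure_uniform_measure[OF sets_lp_ball box]
      by (simp add: lp_ball_infinity emeasure_PiM_interval PiE_Int)
    also have "emeasure (lborel_vec n) (\<Pi>\<^sub>E i\<in>{..<n}. {-1..1} \<inter> A i) = (\<Prod>i<n. emeasure lborel ({-1..1} \<inter> A i))"
      using A by (intro lborel_product.emeasure_PiM) auto
    also have "(\<Prod>i<n. emeasure lborel ({-1..1} \<inter> A i)) / 2 ^ n = (\<Prod>i<n. emeasure lborel ({-1..1} \<inter> A i) / 2)"
    proof -
      have "(2::ennreal) ^ n = (\<Prod>i<n. 2)" by simp
      then show ?thesis
        by (simp add: divide_ennreal_def prod.distrib ennreal_inverse_power)
    qed
    also have "\<dots> = (\<Prod>i<n. emeasure (uniform_measure lborel {-1..1}) (A i))"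
      using A by (intro prod.cong refl) (simp add: emeasure_uniform_measure)
    finally show "emeasure (unif_lp_ball n \<infinity>) (Pi\<^sub>E {..<n} A)
      = (\<Prod>i\<in>{..<n}. emeasure (uniform_measure lborel {-1..1}) (A i))" .
  qed simp
qed

lemma borel_measurable_log_norms_unif[measurable]:
  "log_norms a m q n \<in> borel_measurable (unif_lp_ball n p)"
  using borel_measurable_log_norms[of lborel a m q n] by simp

text \<open>Every norm is homogeneous of degree 1, so the shift is the same in all coordinates. It
  is the logarithm of the radius relative to its typical size \<open>n powr (1 / p)\<close>.\<close>

lemma log_norms_scale_vec:
  assumes r: "r > 0" and n: "n > 0" and x: "x 0 \<noteq> 0" and q: "\<And>i. q i > 0" and m: "\<And>i. m i > 0"
  shows "log_norms 0 m q n (scale_vec n r x) =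
    log_norms (1 / p) m q n x + (\<chi> i. sqrt (real n) * ln (r * real n powr (- (1 / p))))"
proof -
  have "ln (real n powr (0 - 1 / q i) * lp_norm n (ereal (q i)) (scale_vec n r x) / m i powr (1 / q i)) =
    ln (real n powr (1 / p - 1 / q i) * lp_norm n (ereal (q i)) x / m i powr (1 / q i)) + ln (r * real n powr (- (1 / p)))" for i
  proof -
    have "real n powr (0 - 1 / q i) = real n powr (1 / p - 1 / q i) * real n powr (- (1 / p))"
      using n by (simp flip: powr_add)
    then have "real n powr (0 - 1 / q i) * lp_norm n (ereal (q i)) (scale_vec n r x) / m i powr (1 / q i) =
      (real n powr (1 / p - 1 / q i) * lp_norm n (ereal (q i)) x / m i powr (1 / q i)) * (r * real n powr (- (1 / p)))"
      using r q[of i] by (subst lp_norm_scale_vec) auto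
    moreover have "real n powr (1 / p - 1 / q i) * lp_norm n (ereal (q i)) x / m i powr (1 / q i) > 0"
      using n m[of i] lp_norm_pos[OF n, of x "q i"] x by simp
    moreover have "r * real n powr (- (1 / p)) > 0" using r n by simp
    ultimately show ?thesis by (simp only: ln_mult_pos)
  qed
  then show ?thesis by (simp add: log_norms_def vec_eq_iff distrib_left)
qed

definition radial_char :: "real \<Rightarrow> nat \<Rightarrow> real \<Rightarrow> complex" where
  "radial_char p n s = (CLINT r|radial_law p n. cis (s * (sqrt (real n) * ln (r * real n powr (- (1 / p))))))"

text \<open>Fubini for the independent radius and uniform point. Splitting the logarithms needs
  \<open>r > 0\<close> and \<open>x 0 \<noteq> 0\<close>, hence equality only almost everywhere in
  both integrals.\<close>

lemma char_log_norms_factor: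
  fixes q :: "'d::finite \<Rightarrow> real"
  assumes p: "p \<ge> 1" and n: "n > 0" and q: "\<And>i. q i > 0" and m: "\<And>i. m i > 0"
  shows "(CLINT x|PiM {..<n} (\<lambda>_. p_gaussian p). cis (t \<bullet> log_norms 0 m q n x)) =
    radial_char p n (\<Sum>i\<in>UNIV. t $ i) * (CLINT x|unif_lp_ball n (ereal p). cis (t \<bullet> log_norms (1 / p) m q n x))"
proof -
  have p0: "p > 0" using p by simp
  interpret R: prob_space "radial_law p n" by (rule emeasure_lp_ball(3)[OF p0 n])
  interpret U: prob_space "unif_lp_ball n (ereal p)" by (rule prob_space_unif_lp_ball) (use p in simp)
  interpret RU: pair_prob_space "radial_law p n" "unif_lp_ball n (ereal p)" ..
  define f where "f x = cis (t \<bullet> log_norms 0 m q n x)" for x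
  have [measurable]: "f \<in> borel_measurable (lborel_vec n)"
    unfolding f_def using borel_measurable_log_norms[of lborel 0 m q n] by simp
  have sc[measurable]: "(\<lambda>(r, x). scale_vec n r x) \<in> radial_law p n \<Otimes>\<^sub>M unif_lp_ball n (ereal p) \<rightarrow>\<^sub>M lborel_vec n"
    using measurable_scale_vec
    by (simp only: measurable_cong_sets[OF sets_pair_measure_cong[OF sets_radial_law sets_unif_lp_ball] refl])
  have int: "integrable (radial_law p n \<Otimes>\<^sub>M unif_lp_ball n (ereal p)) (\<lambda>z. f (case z of (r, x) \<Rightarrow> scale_vec n r x))"
  proof (rule RU.integrable_const_bound[where B = 1])
    show "(\<lambda>z. f (case z of (r, x) \<Rightarrow> scale_vec n r x)) \<in> borel_measurable (radial_law p n \<Otimes>\<^sub>M unif_lp_ball n (ereal p))"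
      by (rule measurable_compose[OF sc]) simp
  qed (simp add: f_def)
  let ?c = "\<lambda>r. cis ((\<Sum>i\<in>UNIV. t $ i) * (sqrt (real n) * ln (r * real n powr (- (1 / p)))))"
  let ?\<phi> = "CLINT x|unif_lp_ball n (ereal p). cis (t \<bullet> log_norms (1 / p) m q n x)"
  have "(CLINT x|PiM {..<n} (\<lambda>_. p_gaussian p). f x) =
    (CLINT z|radial_law p n \<Otimes>\<^sub>M unif_lp_ball n (ereal p). f (case z of (r, x) \<Rightarrow> scale_vec n r x))"
    unfolding p_gaussian_vec_eq_radial[OF p0 n] by (rule integral_distr[OF sc]) simp
  also have "\<dots> = (CLINT r|radial_law p n. (CLINT x|unif_lp_ball n (ereal p). f (scale_vec n r x)))"
    using RU.integral_fst'[OF int] by simp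
  also have "\<dots> = (CLINT r|radial_law p n. ?c r * ?\<phi>)"
  proof (rule integral_cong_AE)
    show "(\<lambda>r. CLINT x|unif_lp_ball n (ereal p). f (scale_vec n r x)) \<in> borel_measurable (radial_law p n)"
      using RU.integrable_fst'[OF int] by (simp add: borel_measurable_integrable)
    show "(\<lambda>r. ?c r * ?\<phi>) \<in> borel_measurable (radial_law p n)" by measurable
    show "AE r in radial_law p n. (CLINT x|unif_lp_ball n (ereal p). f (scale_vec n r x)) = ?c r * ?\<phi>"
      using AE_radial_law_pos
    proof eventually_elim
      case (elim r)
      have "(CLINT x|unif_lp_ball n (ereal p). f (scale_vec n r x)) =
        (CLINT x|unif_lp_ball n (ereal p). ?c r * cis (t \<bullet> log_norms (1 / p) m q n x))"
      proof (rule integral_cong_AE)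
        have "scale_vec n r \<in> unif_lp_ball n (ereal p) \<rightarrow>\<^sub>M lborel_vec n"
          using measurable_scale_vec_const[of n r] by (simp only: measurable_cong_sets[OF sets_unif_lp_ball refl])
        then show "(\<lambda>x. f (scale_vec n r x)) \<in> borel_measurable (unif_lp_ball n (ereal p))"
          by (rule measurable_compose) simp
        show "AE x in unif_lp_ball n (ereal p). f (scale_vec n r x) = ?c r * cis (t \<bullet> log_norms (1 / p) m q n x)"
          using AE_unif_lp_ball_nonzero[OF n]
        proof eventually_elim
          case (elim x)
          have "t \<bullet> (\<chi> i. sqrt (real n) * ln (r * real n powr (- (1 / p)))) =
            (\<Sum>i\<in>UNIV. t $ i) * (sqrt (real n) * ln (r * real n powr (- (1 / p))))"
            by (simp add: inner_vec_def sum_distrib_right)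
          then show ?case
            unfolding f_def log_norms_scale_vec[where p = p and x = x and q = q and m = m, OF \<open>0 < r\<close> n elim q m] inner_add_right
            by (simp add: cis_mult add.commute)
        qed
      qed measurable
      then show ?case by simp
    qed
  qed
  also have "\<dots> = radial_char p n (\<Sum>i\<in>UNIV. t $ i) * ?\<phi>" by (simp add: radial_char_def)
  finally show ?thesis by (simp add: f_def)
qed

lemma norm_cis_minus_one_le: "norm (cis a - 1) \<le> \<bar>a\<bar>"
  using iexp_approx1[of a 0] by (simp add: cis_conv_exp)

text \<open>The norm of a uniform point exceeds \<open>exp (- e / sqrt n)\<close> outside an event of
  probability \<open>exp (- e * sqrt n)\<close>, so on the scale of the fluctuations it equals 1.\<close>

lemma char_log_radius_tendsto:
  assumes p: "p \<ge> 1"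
  shows "(\<lambda>n. CLINT x|unif_lp_ball n (ereal p). cis (s * (sqrt (real n) * ln (lp_norm n (ereal p) x)))) \<longlonglongrightarrow> 1"
proof (rule LIMSEQ_I)
  fix e :: real assume e: "e > 0"
  \<comment> \<open>Off the set \<open>A\<close> below, the deviation is at most
    \<open>\<bar>s\<bar> * d\<close>, less than half of \<open>e\<close>. On \<open>A\<close> it is
    at most 2, so a probability below \<open>e / 4\<close> costs the other half. The added 1 covers
    \<open>s = 0\<close>.\<close>
  define d where "d = e / (2 * (\<bar>s\<bar> + 1))"
  have d: "d > 0" using e by (simp add: d_def)
  have "(\<lambda>n::nat. exp (- (d * sqrt (real n)))) \<longlonglongrightarrow> 0"
    using d by real_asymp
  then have "\<forall>\<^sub>F n in sequentially. exp (- (d * sqrt (real n))) < e / 4"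
    using e by (intro order_tendstoD) auto
  then have "\<forall>\<^sub>F n in sequentially. norm ((CLINT x|unif_lp_ball n (ereal p). cis (s * (sqrt (real n) * ln (lp_norm n (ereal p) x)))) - 1) < e"
    using eventually_gt_at_top[of 0]
  proof eventually_elim
    case (elim n)
    let ?U = "unif_lp_ball n (ereal p)" and ?N = "lp_norm n (ereal p)"
    interpret U: prob_space ?U by (rule prob_space_unif_lp_ball) (use p in simp)
    have [measurable]: "?N \<in> borel_measurable ?U"
      using borel_measurable_lp_norm[of lborel n "ereal p"] by simp
    define a where "a = exp (- d / sqrt (real n))"
    have a: "0 < a" "a \<le> 1" using d by (auto simp: a_def)
    define A where "A = {x \<in> space ?U. ?N x \<le> a}"
    have [measurable]: "A \<in> sets ?U" unfolding A_def by measurable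
    have space: "space ?U = space (lborel_vec n)" by (rule sets_eq_imp_space_eq) simp
    have "a ^ n = exp (real n * (- d / sqrt (real n)))" by (simp only: a_def exp_of_nat_mult)
    also have "real n * (- d / sqrt (real n)) = - (d * sqrt (real n))"
      using real_div_sqrt[of "real n"] by (metis minus_mult_right mult.commute of_nat_0_le_iff times_divide_eq_left times_divide_eq_right minus_divide_left)
    finally have "a ^ n = exp (- (d * sqrt (real n)))" .
    then have A: "measure ?U A < e / 4"
      using elim p a prob_unif_lp_ball_norm_le[of p n a] unfolding A_def space by simp
    have A_space: "A \<inter> space ?U = A" by (auto simp: A_def)
    have int_A: "integrable ?U (\<lambda>x. indicator A x :: real)"
      by (rule U.integrable_const_bound[where B = 1]) auto
    have int: "integrable ?U (\<lambda>x. cis (s * (sqrt (real n) * ln (?N x))))"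
      by (rule U.integrable_const_bound[where B = 1]) auto
    have "norm ((CLINT x|?U. cis (s * (sqrt (real n) * ln (?N x)))) - 1)
      = norm (CLINT x|?U. cis (s * (sqrt (real n) * ln (?N x))) - 1)"
      using int by (simp add: U.prob_space)
    also have "\<dots> \<le> (\<integral>x. norm (cis (s * (sqrt (real n) * ln (?N x))) - 1) \<partial>?U)"
      by (rule integral_norm_bound)
    also have "\<dots> \<le> (\<integral>x. \<bar>s\<bar> * d + 2 * indicator A x \<partial>?U)"
    proof (rule integral_mono_AE)
      have "AE x in ?U. x \<in> lp_ball n (ereal p)"
        unfolding unif_lp_ball_def by (rule AE_uniform_measureI) auto
      then show "AE x in ?U. norm (cis (s * (sqrt (real n) * ln (?N x))) - 1) \<le> \<bar>s\<bar> * d + 2 * indicator A x"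
      proof eventually_elim
        fix x assume x: "x \<in> lp_ball n (ereal p)"
        show "norm (cis (s * (sqrt (real n) * ln (?N x))) - 1) \<le> \<bar>s\<bar> * d + 2 * indicator A x"
        proof (cases "x \<in> A")
          case True
          have "norm (cis (s * (sqrt (real n) * ln (?N x))) - 1) \<le> 2"
            using norm_triangle_ineq4[of "cis (s * (sqrt (real n) * ln (?N x)))" 1] by simp
          then show ?thesis using True d by (simp add: add_nonneg_nonneg order_trans[of _ 2])
        next
          case False
          then have N: "a < ?N x" "?N x \<le> 1" using x by (auto simp: A_def lp_ball_def space)
          then have "ln a \<le> ln (?N x)" "ln (?N x) \<le> 0" using a by auto
          then have "\<bar>ln (?N x)\<bar> \<le> d / sqrt (real n)" by (simp add: a_def)
          then have "sqrt (real n) * \<bar>ln (?N x)\<bar> \<le> d"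
            using elim by (simp add: field_simps)
          then have "\<bar>s * (sqrt (real n) * ln (?N x))\<bar> \<le> \<bar>s\<bar> * d"
            by (simp add: abs_mult mult_left_mono)
          then show ?thesis using norm_cis_minus_one_le False by (auto intro: order_trans)
        qed
      qed
      show "integrable ?U (\<lambda>x. norm (cis (s * (sqrt (real n) * ln (?N x))) - 1))"
        using int by simp
      show "integrable ?U (\<lambda>x. \<bar>s\<bar> * d + 2 * indicator A x)"
        using int_A by simp
    qed
    also have "\<dots> = \<bar>s\<bar> * d + 2 * measure ?U A"
      using int_A by (subst Bochner_Integration.integral_add) (simp_all add: U.prob_space A_space)
    also have "\<dots> < (\<bar>s\<bar> + 1) * d + e / 2"
      using A d by (simp add: distrib_right)
    also have "(\<bar>s\<bar> + 1) * d = e / 2" by (simp add: d_def field_simps add_pos_nonneg)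
    finally show ?case by simp
  qed
  then show "\<exists>N. \<forall>n\<ge>N. norm ((CLINT x|unif_lp_ball n (ereal p). cis (s * (sqrt (real n) * ln (lp_norm n (ereal p) x)))) - 1) < e"
    by (simp add: eventually_sequentially)
qed

text \<open>The factorisation for the single exponent \<open>q = p\<close> determines the limit of the
  radial factor, since \<open>p\<close>-norms of uniform points have no fluctuations at this scale.\<close>

lemma radial_char_tendsto:
  assumes p: "p \<ge> 1"
  shows "(\<lambda>n. radial_char p n s) \<longlonglongrightarrow> complex_of_real (exp (- (s\<^sup>2 / p) / 2))"
proof -
  have p0: "p > 0" using p by simp
  have M1: "Mp (ereal p) p = 1" using Mp_add_self[of p 0] p by (simp add: Mp_0)
  then have M2: "Mp (ereal p) (p + p) = p + 1" using Mp_add_self[of p p] p by simp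
  \<comment> \<open>With the single exponent \<open>p\<close>, the covariance is
    \<open>(M(2p) - M(p)^2) / p^2 = (p + 1 - 1) / p^2 = 1 / p\<close>.\<close>
  define C :: "real^1^1" where "C = (\<chi> i j. 1 / p)"
  define t :: "real^1" where "t = (\<chi> i. s)"
  have "(\<lambda>n. CLINT x|PiM {..<n} (\<lambda>_. p_gaussian p). cis (t \<bullet> log_norms 0 (\<lambda>i. Mp (ereal p) p) (\<lambda>_. p) n x))
    \<longlonglongrightarrow> complex_of_real (exp (- (t \<bullet> (C *v t)) / 2))"
  proof (rule log_norms_clt[where M = "Mp (ereal p)"])
    show "C $ i $ j = (Mp (ereal p) (p + p) - Mp (ereal p) p * Mp (ereal p) p) / (p * p * Mp (ereal p) p * Mp (ereal p) p)" for i j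
      unfolding M1 M2 using p0 by (simp add: C_def)
  qed (use p0 prob_space_p_gaussian p_gaussian_moment Mp_pos in auto)
  moreover have "t \<bullet> (C *v t) = s\<^sup>2 / p"
    by (simp add: t_def C_def inner_vec_def matrix_vector_mult_def power2_eq_square)
  moreover have "\<forall>\<^sub>F n in sequentially. (CLINT x|PiM {..<n} (\<lambda>_. p_gaussian p). cis (t \<bullet> log_norms 0 (\<lambda>i. Mp (ereal p) p) (\<lambda>_. p) n x))
    = radial_char p n s * (CLINT x|unif_lp_ball n (ereal p). cis (s * (sqrt (real n) * ln (lp_norm n (ereal p) x))))"
    using eventually_gt_at_top[of 0]
  proof eventually_elim
    case (elim n)
    have "t \<bullet> log_norms (1 / p) (\<lambda>i. Mp (ereal p) p) (\<lambda>_. p) n x = s * (sqrt (real n) * ln (lp_norm n (ereal p) x))" for x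
      using elim by (simp add: t_def log_norms_def inner_vec_def M1)
    moreover have "(\<Sum>i\<in>UNIV. t $ i) = s" by (simp add: t_def)
    ultimately show ?case
      using char_log_norms_factor[OF p elim, of "\<lambda>_::1. p" "\<lambda>_. Mp (ereal p) p" t] p0 M1 by simp
  qed
  ultimately have "(\<lambda>n. radial_char p n s * (CLINT x|unif_lp_ball n (ereal p). cis (s * (sqrt (real n) * ln (lp_norm n (ereal p) x)))))
      \<longlonglongrightarrow> complex_of_real (exp (- (s\<^sup>2 / p) / 2))"
    by (simp add: tendsto_cong)
  from tendsto_divide[OF this char_log_radius_tendsto[OF p, of s]]
  have lim: "(\<lambda>n. radial_char p n s * (CLINT x|unif_lp_ball n (ereal p). cis (s * (sqrt (real n) * ln (lp_norm n (ereal p) x)))) /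
      (CLINT x|unif_lp_ball n (ereal p). cis (s * (sqrt (real n) * ln (lp_norm n (ereal p) x)))))
      \<longlonglongrightarrow> complex_of_real (exp (- (s\<^sup>2 / p) / 2))" by simp
  \<comment> \<open>Cancelling the divisor is allowed for large \<open>n\<close>, since it tends to
    1.\<close>
  have "\<forall>\<^sub>F n in sequentially. (CLINT x|unif_lp_ball n (ereal p). cis (s * (sqrt (real n) * ln (lp_norm n (ereal p) x)))) \<noteq> 0"
    by (rule tendsto_imp_eventually_ne[OF char_log_radius_tendsto[OF p]]) simp
  then show ?thesis
    by (intro Lim_transform_eventually[OF lim]) (auto elim!: eventually_mono)
qed

lemma char_log_norms_tendsto:
  fixes q :: "'d::finite \<Rightarrow> real"
  assumes p: "1 \<le> p" and q: "\<And>i. q i > 0"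
  shows "(\<lambda>n. CLINT x|unif_lp_ball n p. cis (t \<bullet> log_norms (inv_exp p) (\<lambda>i. Mp p (q i)) q n x))
    \<longlonglongrightarrow> complex_of_real (exp (- (t \<bullet> ((\<chi> i j. cov1 p (q i) (q j)) *v t)) / 2))"
proof (cases "p = \<infinity>")
  case True
  have "(\<lambda>n. CLINT x|PiM {..<n} (\<lambda>_. uniform_measure lborel {-1..1}). cis (t \<bullet> log_norms 0 (\<lambda>i. Mp \<infinity> (q i)) q n x))
    \<longlonglongrightarrow> complex_of_real (exp (- (t \<bullet> ((\<chi> i j. cov1 p (q i) (q j)) *v t)) / 2))"
  proof (rule log_norms_clt)
    show "prob_space (uniform_measure lborel {-1..1::real})"
      by (rule prob_space_uniform_measure) auto
    show "Mp \<infinity> r > 0" if "r > 0" for r using that by (simp add: Mp_def)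
    show "(\<chi> i j. cov1 p (q i) (q j)) $ i $ j =
      (Mp \<infinity> (q i + q j) - Mp \<infinity> (q i) * Mp \<infinity> (q j)) / (q i * q j * Mp \<infinity> (q i) * Mp \<infinity> (q j))" for i j
      using True by (simp add: cov1_def Cp_def)
  qed (use q uniform_cube_moment in auto)
  then show ?thesis by (simp add: True inv_exp_def unif_lp_ball_infinity)
next
  case False
  then obtain p' where pp: "p = ereal p'" and p': "p' \<ge> 1" using p by (cases p) auto
  then have p0: "p' > 0" by simp
  define A :: "real^'d^'d" where
    "A = (\<chi> i j. Cp p (q i) (q j) / (q i * q j * Mp p (q i) * Mp p (q j)))"
  define s where "s = (\<Sum>i\<in>UNIV. t $ i)"
  have lim: "(\<lambda>n. CLINT x|PiM {..<n} (\<lambda>_. p_gaussian p'). cis (t \<bullet> log_norms 0 (\<lambda>i. Mp p (q i)) q n x))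
    \<longlonglongrightarrow> complex_of_real (exp (- (t \<bullet> (A *v t)) / 2))"
    unfolding pp
  proof (rule log_norms_clt)
    show "A $ i $ j = (Mp (ereal p') (q i + q j) - Mp (ereal p') (q i) * Mp (ereal p') (q j)) /
      (q i * q j * Mp (ereal p') (q i) * Mp (ereal p') (q j))" for i j
      by (simp add: A_def Cp_def pp)
  qed (use p0 q prob_space_p_gaussian p_gaussian_moment Mp_pos in auto)
  \<comment> \<open>The Gaussian limit is nonzero, so the radial factor can eventually be divided
    out.\<close>
  have nz: "\<forall>\<^sub>F n in sequentially. radial_char p' n s \<noteq> 0"
    by (rule tendsto_imp_eventually_ne[OF radial_char_tendsto[OF p']]) simp
  \<comment> \<open>Subtracting \<open>1 / p'\<close> from every entry of \<open>A\<close> lowers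
    the quadratic form by the square of the coordinate sum over \<open>p'\<close>, which is the
    exponent of the radial limit.\<close>
  have quad: "t \<bullet> ((\<chi> i j. cov1 p (q i) (q j)) *v t) = t \<bullet> (A *v t) - s\<^sup>2 / p'"
  proof -
    have "(\<chi> i j. cov1 p (q i) (q j)) = (\<chi> i j. A $ i $ j - 1 / p')"
      using cov1_finite[OF p0 q q] by (simp add: vec_eq_iff A_def pp)
    then have "t \<bullet> ((\<chi> i j. cov1 p (q i) (q j)) *v t) =
        (\<Sum>i\<in>UNIV. \<Sum>j\<in>UNIV. t $ i * (A $ i $ j * t $ j)) - (\<Sum>i\<in>UNIV. \<Sum>j\<in>UNIV. t $ i * (t $ j / p'))"
      by (simp add: inner_vec_def matrix_vector_mult_def sum_distrib_left algebra_simps sum_subtractf)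
    also have "(\<Sum>i\<in>UNIV. \<Sum>j\<in>UNIV. t $ i * (t $ j / p')) = s\<^sup>2 / p'"
      by (simp add: s_def power2_eq_square sum_product sum_divide_distrib)
    finally show ?thesis by (simp add: inner_vec_def matrix_vector_mult_def sum_distrib_left)
  qed
  from tendsto_divide[OF lim radial_char_tendsto[OF p', of s]]
  have "(\<lambda>n. (CLINT x|PiM {..<n} (\<lambda>_. p_gaussian p'). cis (t \<bullet> log_norms 0 (\<lambda>i. Mp p (q i)) q n x)) / radial_char p' n s)
    \<longlonglongrightarrow> complex_of_real (exp (- (t \<bullet> (A *v t)) / 2) / exp (- (s\<^sup>2 / p') / 2))" by simp
  also have "exp (- (t \<bullet> (A *v t)) / 2) / exp (- (s\<^sup>2 / p') / 2) = exp (- (t \<bullet> ((\<chi> i j. cov1 p (q i) (q j)) *v t)) / 2)"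
    unfolding quad exp_diff[symmetric] by (simp add: diff_divide_distrib)
  finally show ?thesis
  proof (rule Lim_transform_eventually)
    show "\<forall>\<^sub>F n in sequentially.
      (CLINT x|PiM {..<n} (\<lambda>_. p_gaussian p'). cis (t \<bullet> log_norms 0 (\<lambda>i. Mp p (q i)) q n x)) / radial_char p' n s =
      (CLINT x|unif_lp_ball n p. cis (t \<bullet> log_norms (inv_exp p) (\<lambda>i. Mp p (q i)) q n x))"
      using nz eventually_gt_at_top[of 0]
    proof eventually_elim
      case (elim n)
      have "Mp p (q i) > 0" for i using Mp_pos[of p' "q i"] p0 q[of i] by (simp add: pp)
      then show ?case
        using char_log_norms_factor[OF p' elim(2), of q "\<lambda>i. Mp p (q i)" t] q elim(1)
        by (simp add: pp inv_exp_def s_def)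
    qed
  qed
qed

lemma Mp_pos': "1 \<le> p \<Longrightarrow> r > 0 \<Longrightarrow> Mp p r > 0"
  by (cases p) (auto simp: Mp_pos Mp_def[of \<infinity>])

lemma lp_norms_unif_weak_limit:
  fixes q :: "'d::finite \<Rightarrow> real"
  assumes p: "1 \<le> p" and q: "\<And>i. q i > 0"
  shows "\<exists>N. centered_gaussian (\<chi> i j. cov1 p (q i) (q j)) N \<and>
           weak_conv_vec
             (\<lambda>n. distr (unif_lp_ball n p) borel
                (\<lambda>z. \<chi> i. sqrt (real n) *
                    (real n powr (inv_exp p - 1 / q i) * lp_norm n (ereal (q i)) z
                      / Mp p (q i) powr (1 / q i) - 1)))
             N"
proof -
  define C :: "real^'d^'d" where "C = (\<chi> i j. cov1 p (q i) (q j))"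
  define L where "L n = log_norms (inv_exp p) (\<lambda>i. Mp p (q i)) q n" for n
  define \<mu> where "\<mu> n = distr (unif_lp_ball n p) borel (L n)" for n
  have U: "prob_space (unif_lp_ball n p)" for n by (rule prob_space_unif_lp_ball[OF p])
  have [measurable]: "L n \<in> borel_measurable (unif_lp_ball n p)" for n unfolding L_def by measurable
  have \<mu>: "prob_space (\<mu> n)" "sets (\<mu> n) = sets borel" for n
    unfolding \<mu>_def using U by (auto intro: prob_space.prob_space_distr)
  have char: "(\<lambda>n. CLINT x|\<mu> n. cis (t \<bullet> x)) \<longlonglongrightarrow> complex_of_real (exp (- (t \<bullet> (C *v t)) / 2))" for t
  proof -
    have "(CLINT x|\<mu> n. cis (t \<bullet> x)) = (CLINT x|unif_lp_ball n p. cis (t \<bullet> L n x))" for n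
      unfolding \<mu>_def by (intro integral_distr) auto
    then show ?thesis using char_log_norms_tendsto[OF p q, of t] by (simp add: L_def C_def)
  qed
  \<comment> \<open>Here \<open>C\<close> is a difference, so its form is not visibly a variance. A
    negative value would make the limit of the characteristic functions exceed 1 in modulus.\<close>
  have psd: "0 \<le> t \<bullet> (C *v t)" for t
  proof -
    have "norm (CLINT x|\<mu> n. cis (t \<bullet> x)) \<le> 1" for n
    proof -
      interpret M: prob_space "\<mu> n" by (rule \<mu>)
      have "norm (CLINT x|\<mu> n. cis (t \<bullet> x)) \<le> (\<integral>x. norm (cis (t \<bullet> x)) \<partial>\<mu> n)"
        by (rule integral_norm_bound)
      then show ?thesis by (simp add: M.prob_space)
    qed
    then have "norm (complex_of_real (exp (- (t \<bullet> (C *v t)) / 2))) \<le> 1"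
      by (intro tendsto_upperbound[OF tendsto_norm[OF char]]) auto
    then show ?thesis by simp
  qed
  have "\<exists>N. centered_gaussian C N"
    by (intro ex_centered_gaussian psd)
       (simp add: C_def cov1_def Cp_def algebra_simps)
  then obtain N where N: "centered_gaussian C N" by blast
  then have N': "prob_space N" "sets N = sets borel"
    "\<And>t. (CLINT x|N. cis (t \<bullet> x)) = complex_of_real (exp (- (t \<bullet> (C *v t)) / 2))"
    by (auto simp: centered_gaussian_def)
  have w: "weak_conv_vec \<mu> N"
    using char by (intro levy_continuity_vec \<mu> N') (simp add: N')
  define h where "h n x = (\<chi> i. sqrt (real n) * (exp (x $ i / sqrt (real n)) - 1))" for n :: nat and x :: "real^'d"
  have [measurable]: "h n \<in> borel_measurable borel" for n unfolding h_def by measurable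
  have conv: "weak_conv_vec (\<lambda>n. distr (\<mu> n) borel (h n)) N"
  proof (rule weak_conv_vec_perturb[OF \<mu> N'(1,2) w])
    fix K e :: real assume "e > 0"
    then show "\<forall>\<^sub>F n in sequentially. \<forall>x. norm x \<le> K \<longrightarrow> norm (h n x - x) < e"
      unfolding h_def by (intro uniformly_id_vec uniformly_id_exp)
  qed measurable
  define X where "X n z = (\<chi> i. sqrt (real n) * (real n powr (inv_exp p - 1 / q i) * lp_norm n (ereal (q i)) z
                      / Mp p (q i) powr (1 / q i) - 1))" for n z
  have [measurable]: "X n \<in> borel_measurable (unif_lp_ball n p)" for n
  proof -
    have [measurable]: "lp_norm n (ereal (q i)) \<in> borel_measurable (unif_lp_ball n p)" for i
      using borel_measurable_lp_norm[of lborel n "ereal (q i)"] by simp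
    show ?thesis unfolding X_def by measurable
  qed
  have eq: "distr (\<mu> n) borel (h n) = distr (unif_lp_ball n p) borel (X n)" if n: "n > 0" for n
  proof -
    have "distr (\<mu> n) borel (h n) = distr (unif_lp_ball n p) borel (\<lambda>z. h n (L n z))"
      unfolding \<mu>_def by (subst distr_distr) (auto simp: comp_def)
    also have "\<dots> = distr (unif_lp_ball n p) borel (X n)"
    proof (rule distr_cong_AE)
      \<comment> \<open>\<open>exp\<close> undoes \<open>ln\<close> at positive arguments, so
        vectors of norm 0 are set aside as a null set.\<close>
      show "AE z in unif_lp_ball n p. h n (L n z) = X n z"
        using AE_unif_lp_ball_nonzero[OF n]
      proof eventually_elim
        case (elim z)
        have "real n powr (inv_exp p - 1 / q i) * lp_norm n (ereal (q i)) z / Mp p (q i) powr (1 / q i) > 0" for i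
          using n lp_norm_pos[OF n, of z "q i"] elim Mp_pos'[OF p q[of i]] by simp
        then show ?case using n by (simp add: h_def L_def X_def log_norms_def vec_eq_iff)
      qed
    qed auto
    finally show ?thesis .
  qed
  have "weak_conv_vec (\<lambda>n. distr (unif_lp_ball n p) borel (X n)) N"
    unfolding weak_conv_vec_def
  proof (intro allI impI)
    fix f :: "real^'d \<Rightarrow> real" assume "continuous_on UNIV f \<and> bounded (range f)"
    then have "(\<lambda>n. \<integral>x. f x \<partial>distr (\<mu> n) borel (h n)) \<longlonglongrightarrow> (\<integral>x. f x \<partial>N)"
      using conv by (simp add: weak_conv_vec_def)
    then show "(\<lambda>n. \<integral>x. f x \<partial>distr (unif_lp_ball n p) borel (X n)) \<longlonglongrightarrow> (\<integral>x. f x \<partial>N)"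
      by (rule Lim_transform_eventually)
         (use eventually_gt_at_top[of 0] in \<open>eventually_elim, simp add: eq\<close>)
  qed
  then show "\<exists>N. centered_gaussian (\<chi> i j. cov1 p (q i) (q j)) N \<and>
           weak_conv_vec
             (\<lambda>n. distr (unif_lp_ball n p) borel
                (\<lambda>z. \<chi> i. sqrt (real n) *
                    (real n powr (inv_exp p - 1 / q i) * lp_norm n (ereal (q i)) z
                      / Mp p (q i) powr (1 / q i) - 1)))
             N"
    using N unfolding C_def X_def by (intro exI[of _ N] conjI)
qed

theorem theorem1p1:
  fixes p :: ereal and q :: "'d::{finite,linorder} \<Rightarrow> real"
  assumes "1 \<le> p"
    and "strict_mono q"
    and "\<And>i. 1 \<le> q i"
    and "\<And>i. p \<noteq> ereal (q i)"
  shows "(\<exists>N. centered_gaussian (\<chi> i j. cov1 p (q i) (q j)) N \<and>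
           weak_conv_vec
             (\<lambda>n. distr (unif_lp_ball n p) borel
                (\<lambda>z. \<chi> i. sqrt (real n) *
                    (real n powr (inv_exp p - 1 / q i) * lp_norm n (ereal (q i)) z
                      / Mp p (q i) powr (1 / q i) - 1)))
             N)
         \<and> (\<forall>i j. cov1 p (q i) (q j) = cov2 p (q i) (q j))"
proof -
  have q: "q i > 0" for i using assms(3)[of i] by linarith
  have "cov1 p (q i) (q j) = cov2 p (q i) (q j)" for i j
    using assms(1) q by (intro cov1_eq_cov2) (auto intro: less_le_trans[of _ 1])
  then show ?thesis
    by (intro conjI allI lp_norms_unif_weak_limit[OF assms(1), of q] q)
qed

end
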